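(* Let $A$ be a nonzero closed densely defined operator in a complex Hilbert space $\mathcal H$. Then the following two conditions are equivalent: (i) $A$ is quasinormal; (ii) $A$ is weakly quasinormal with $\mathfrak c_A=1$.
   Context: All operators are linear and possibly unbounded; $\mathcal D(A)$ denotes the domain of $A$. $\mathbb R_+=[0,\infty)$ and $\mathfrak B(\mathbb R_+)$ is its Borel $\sigma$-algebra. For a closed densely defined $A$, $|A|$ is the square root of the positive selfadjoint operator $A^*A$ (so $\mathcal D(|A|)=\mathcal D(A)$), and $E$ denotes the spectral measure of $|A|$, regarded as defined on $\mathfrak B(\mathbb R_+)$. $S\subseteq T$ means $\mathcal D(S)\subseteq\mathcal D(T)$ and $Sf=Tf$ for $f\in\mathcal D(S)$. A closed densely defined operator $A$ is called quasinormal if $E(\sigma)A\subseteq AE(\sigma)$ for all $\sigma\in\mathfrak B(\mathbb R_+)$. It is called weakly quasinormal if there exists $c\in\mathbb R_+$ such that $\langle E(\sigma)|A|f,|A|f\rangle\leqslant c\,\langle E(\sigma)Af,Af\rangle$ for all $\sigma\in\mathfrak B(\mathbb R_+)$ and $f\in\mathcal D(A)$; the smallest such $c$ is denoted by $\mathfrak c_A$. *)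

theory Defs
  imports "HOL-Analysis.Analysis"
begin

class complex_vector = real_vector +
  fixes scaleC :: "complex \<Rightarrow> 'a \<Rightarrow> 'a"  (infixr "*\<^sub>C" 75)
  assumes scaleC_add_right: "a *\<^sub>C (x + y) = a *\<^sub>C x + a *\<^sub>C y"
    and scaleC_add_left: "(a + b) *\<^sub>C x = a *\<^sub>C x + b *\<^sub>C x"
    and scaleC_scaleC: "a *\<^sub>C b *\<^sub>C x = (a * b) *\<^sub>C x"
    and scaleC_one: "1 *\<^sub>C x = x"
    and scaleR_scaleC: "r *\<^sub>R x = complex_of_real r *\<^sub>C x"

text \<open>The inner product is linear in its first argument.\<close>

class complex_hilbert = complex_vector + banach +
  fixes cinner :: "'a \<Rightarrow> 'a \<Rightarrow> complex"
  assumes cinner_commute: "cinner x y = cnj (cinner y x)"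
    and cinner_add_left: "cinner (x + y) z = cinner x z + cinner y z"
    and cinner_scaleC_left: "cinner (a *\<^sub>C x) y = a * cinner x y"
    and cinner_norm: "cinner x x = complex_of_real ((norm x)\<^sup>2)"

text \<open>
  An unbounded operator is a partial map, so that its domain is \<open>dom\<close>, its graph is
  \<open>Map.graph\<close>, the product \<open>S T\<close> with its maximal domain is \<open>S \<circ>\<^sub>m T\<close>, and the
  extension relation is \<open>\<subseteq>\<^sub>m\<close>. An everywhere defined operator \<open>P\<close>
  is regarded as the partial map \<open>Some \<circ> P\<close>.
\<close>

type_synonym 'a operator = "'a \<rightharpoonup> 'a"

definition linear_op :: "'a::complex_vector operator \<Rightarrow> bool" where
  "linear_op A \<longleftrightarrow>
     A 0 = Some 0 \<and>
     (\<forall>f g u v. A f = Some u \<longrightarrow> A g = Some v \<longrightarrow> A (f + g) = Some (u + v)) \<and>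
     (\<forall>a f u. A f = Some u \<longrightarrow> A (a *\<^sub>C f) = Some (a *\<^sub>C u))"

definition closed_op :: "'a::complex_hilbert operator \<Rightarrow> bool" where
  "closed_op A \<longleftrightarrow> closed (Map.graph A)"

definition densely_defined :: "'a::complex_hilbert operator \<Rightarrow> bool" where
  "densely_defined A \<longleftrightarrow> closure (dom A) = UNIV"

text \<open>Only meaningful for densely defined \<open>A\<close>, for which \<open>h\<close> is unique.\<close>

definition adjoint_op :: "'a::complex_hilbert operator \<Rightarrow> 'a operator" where
  "adjoint_op A = (\<lambda>g.
     if \<exists>h. \<forall>f\<in>dom A. cinner (the (A f)) g = cinner f h
     then Some (THE h. \<forall>f\<in>dom A. cinner (the (A f)) g = cinner f h)
     else None)"

definition selfadjoint_op :: "'a::complex_hilbert operator \<Rightarrow> bool" where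
  "selfadjoint_op A \<longleftrightarrow> linear_op A \<and> densely_defined A \<and> adjoint_op A = A"

definition positive_op :: "'a::complex_hilbert operator \<Rightarrow> bool" where
  "positive_op A \<longleftrightarrow> (\<forall>f\<in>dom A. cinner (the (A f)) f \<in> \<real>\<^sub>\<ge>\<^sub>0)"

text \<open>\<open>B = |A|\<close>: the (unique) positive selfadjoint square root of \<open>A\<^sup>* A\<close>.\<close>

definition is_modulus :: "'a::complex_hilbert operator \<Rightarrow> 'a operator \<Rightarrow> bool" where
  "is_modulus A B \<longleftrightarrow>
     selfadjoint_op B \<and> positive_op B \<and> B \<circ>\<^sub>m B = adjoint_op A \<circ>\<^sub>m A"

abbreviation borel_Rplus :: "real measure" where
  "borel_Rplus \<equiv> restrict_space borel {0..}"

definition orthogonal_projection :: "('a::complex_hilbert \<Rightarrow> 'a) \<Rightarrow> bool" where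
  "orthogonal_projection P \<longleftrightarrow>
     (\<forall>f g. P (f + g) = P f + P g) \<and> (\<forall>a f. P (a *\<^sub>C f) = a *\<^sub>C P f) \<and>
     (\<forall>f. P (P f) = P f) \<and> (\<forall>f g. cinner (P f) g = cinner f (P g))"

text \<open>
  Projection-valued measures on the Borel subsets of \<open>[0, \<infinity>)\<close>; countable
  additivity is in the strong operator topology. Values of \<open>E\<close> outside the
  sigma-algebra are irrelevant.
\<close>

definition spectral_measure :: "(real set \<Rightarrow> 'a::complex_hilbert \<Rightarrow> 'a) \<Rightarrow> bool" where
  "spectral_measure E \<longleftrightarrow>
     (\<forall>\<sigma>\<in>sets borel_Rplus. orthogonal_projection (E \<sigma>)) \<and>
     (\<forall>f. E {0..} f = f) \<and>
     (\<forall>\<sigma> :: nat \<Rightarrow> real set. range \<sigma> \<subseteq> sets borel_Rplus \<longrightarrow> disjoint_family \<sigma> \<longrightarrow>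
        (\<forall>f. (\<lambda>n. E (\<sigma> n) f) sums E (\<Union>n. \<sigma> n) f))"

text \<open>The positive measure \<open>\<sigma> \<mapsto> \<langle>E(\<sigma>) f, f\<rangle>\<close>.\<close>

definition scalar_measure ::
    "(real set \<Rightarrow> 'a::complex_hilbert \<Rightarrow> 'a) \<Rightarrow> 'a \<Rightarrow> real measure" where
  "scalar_measure E f =
     measure_of {0..} (sets borel_Rplus) (\<lambda>\<sigma>. ennreal (Re (cinner (E \<sigma> f) f)))"

text \<open>
  \<open>B = \<integral> t dE(t)\<close>: the spectral integral is the linear operator whose domain consists
  of the vectors \<open>f\<close> with \<open>\<integral> t\<^sup>2 d\<langle>E(t) f, f\<rangle> < \<infinity>\<close> and whose quadratic form is
  \<open>\<integral> t d\<langle>E(t) f, f\<rangle>\<close>. By polarization the latter determines \<open>B\<close>.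
\<close>

definition is_spectral_measure_of ::
    "(real set \<Rightarrow> 'a::complex_hilbert \<Rightarrow> 'a) \<Rightarrow> 'a operator \<Rightarrow> bool" where
  "is_spectral_measure_of E B \<longleftrightarrow>
     spectral_measure E \<and> linear_op B \<and>
     dom B = {f. (\<integral>\<^sup>+ t. ennreal (t\<^sup>2) \<partial>scalar_measure E f) < \<infinity>} \<and>
     (\<forall>f\<in>dom B. cinner (the (B f)) f =
        complex_of_real (\<integral> t. t \<partial>scalar_measure E f))"

text \<open>
  In the next two definitions \<open>B\<close> and \<open>E\<close> are \<open>|A|\<close> and its spectral measure. Both
  exist and are unique by the spectral theorem, so the existential quantifiers only
  name them.
\<close>

definition quasinormal :: "'a::complex_hilbert operator \<Rightarrow> bool" where
  "quasinormal A \<longleftrightarrow>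
     linear_op A \<and> closed_op A \<and> densely_defined A \<and>
     (\<exists>B E. is_modulus A B \<and> is_spectral_measure_of E B \<and>
        (\<forall>\<sigma>\<in>sets borel_Rplus. (Some \<circ> E \<sigma>) \<circ>\<^sub>m A \<subseteq>\<^sub>m A \<circ>\<^sub>m (Some \<circ> E \<sigma>)))"

text \<open>The inner products below are real because \<open>E \<sigma>\<close> is an orthogonal projection.\<close>

definition weak_quasinormality_bound :: "'a::complex_hilbert operator \<Rightarrow> real \<Rightarrow> bool" where
  "weak_quasinormality_bound A c \<longleftrightarrow>
     0 \<le> c \<and>
     (\<exists>B E. is_modulus A B \<and> is_spectral_measure_of E B \<and>
        (\<forall>\<sigma>\<in>sets borel_Rplus. \<forall>f\<in>dom A.
           Re (cinner (E \<sigma> (the (B f))) (the (B f)))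
             \<le> c * Re (cinner (E \<sigma> (the (A f))) (the (A f)))))"

definition weakly_quasinormal :: "'a::complex_hilbert operator \<Rightarrow> bool" where
  "weakly_quasinormal A \<longleftrightarrow>
     linear_op A \<and> closed_op A \<and> densely_defined A \<and>
     (\<exists>c. weak_quasinormality_bound A c)"

definition weak_quasinormality_constant :: "'a::complex_hilbert operator \<Rightarrow> real" where
  "weak_quasinormality_constant A = (LEAST c. weak_quasinormality_bound A c)"

end

(*
  Write B for |A| and E for its spectral measure. Since B^2 = A^* A and the domain of A^* A is a
  core for A and for B, D(A) = D(B) and ||A f|| = ||B f||. As E(s) commutes with B, weak
  quasinormality with constant c reads ||A E(s) f||^2 <= c ||E(s) A f||^2. For c = 1 the
  inequalities for s and its complement add up to an equality, so both are equalities; applied to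
  E(s) f and f - E(s) f they give E(s) A f = A E(s) f. The converse is immediate, and s = [0, oo)
  shows that no constant below 1 is possible for nonzero A.

  The least constant is attained only because all constants refer to the same E. No functional
  calculus is needed for this uniqueness: f lies in the range of E [0, a] iff
  ||B^(2n) f|| <= a^(2n) ||f|| for all n, and B^2 = A^* A is determined by A.
*)

theory Submission
  imports Defs
begin

section \<open>Geometry of complex Hilbert spaces\<close>

text \<open>\<open>is_spectral_measure_of\<close> ties \<open>E\<close> to \<open>B\<close> only
  through the domain and the quadratic form. That \<open>E \<sigma>\<close> commutes with
  \<open>B\<close>, and every norm estimate for \<open>B\<close> on a spectral subspace, must
  therefore be extracted from the form: splitting a vector along \<open>E \<sigma>\<close> and its
  complement leaves no cross terms, and a bound for t on a set bounds the form on the corresponding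
  range. Turning an upper bound of the form into one of the norm uses positivity at an auxiliary
  vector. Similarly, |A| f and A f visibly have the same norm only where \<open>adjoint_op A\<close>
  can be applied to A f. Reaching all of D(A) is what the core property is for; it comes from
  orthogonal projection onto graphs in the product Hilbert space. The step from the sets [0, a] to
  all Borel sets is measure theoretic: finite Borel measures on the line are determined by their
  tails, and a projection fixes exactly the vectors whose norm it preserves.\<close>

lemma scaleC_zero_right [simp]: "a *\<^sub>C 0 = (0::'a::complex_vector)"
  using scaleC_add_right[of a 0 0] by simp

lemma scaleC_minus_one: "(-1) *\<^sub>C x = - (x::'a::complex_vector)"
  using scaleR_scaleC[of "-1" x] by simp

lemma cinner_scaleR_left: "cinner (r *\<^sub>R x) y = r *\<^sub>R cinner x y"
  by (simp add: scaleR_scaleC cinner_scaleC_left scaleR_conv_of_real)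

lemma cinner_add_right: "cinner x (y + z) = cinner x y + cinner x z"
  by (metis cinner_add_left cinner_commute complex_cnj_add)

lemma cinner_scaleC_right: "cinner x (a *\<^sub>C y) = cnj a * cinner x y"
  by (metis cinner_scaleC_left cinner_commute complex_cnj_mult)

lemma cinner_scaleR_right: "cinner x (r *\<^sub>R y) = r *\<^sub>R cinner x y"
  by (simp add: scaleR_scaleC cinner_scaleC_right scaleR_conv_of_real)

lemma cinner_zero_left [simp]: "cinner 0 x = 0"
  using cinner_add_left[of 0 0 x] by simp

lemma cinner_zero_right [simp]: "cinner x 0 = 0"
  using cinner_add_right[of x 0 0] by simp

lemma cinner_diff_left: "cinner (x - y) z = cinner x z - cinner y z"
  using cinner_add_left[of "x - y" y z] by simp

lemma cinner_diff_right: "cinner x (y - z) = cinner x y - cinner x z"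
  using cinner_add_right[of x "y - z" z] by simp

lemma norm_sq_cinner: "(norm x)\<^sup>2 = Re (cinner x x)"
  by (simp add: cinner_norm)

lemma Re_cinner_commute: "Re (cinner x y) = Re (cinner y x)"
  using cinner_commute[of x y] by simp

text \<open>Pythagoras for the residual of \<open>x\<close> after its component along
  \<open>y\<close> is removed. Nonnegativity of the left side is the Cauchy-Schwarz inequality; the
  decrease on the right side later forces a closest point to have an orthogonal residual.\<close>

lemma norm_diff_component_sq:
  assumes "y \<noteq> 0"
  shows "(norm (x - (cinner x y / of_real ((norm y)\<^sup>2)) *\<^sub>C y))\<^sup>2
    = (norm x)\<^sup>2 - (cmod (cinner x y))\<^sup>2 / (norm y)\<^sup>2"
proof -
  define a where "a = cinner x y / of_real ((norm y)\<^sup>2)"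
  have ay: "a * of_real ((norm y)\<^sup>2) = cinner x y"
    using assms by (simp add: a_def)
  have "cinner (x - a *\<^sub>C y) (x - a *\<^sub>C y)
      = cinner x x - cnj a * cinner x y - a * cinner y x + cnj a * (a * cinner y y)"
    by (simp add: cinner_diff_left cinner_diff_right cinner_scaleC_left cinner_scaleC_right algebra_simps)
  also have "\<dots> = cinner x x - a * cinner y x"
    by (simp add: cinner_norm ay del: of_real_power)
  also have "a * cinner y x = of_real ((cmod (cinner x y))\<^sup>2 / (norm y)\<^sup>2)"
    using cinner_commute[of y x]
    by (simp add: a_def flip: complex_norm_square)
  finally have "complex_of_real ((norm (x - a *\<^sub>C y))\<^sup>2)
      = of_real ((norm x)\<^sup>2 - (cmod (cinner x y))\<^sup>2 / (norm y)\<^sup>2)"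
    by (simp add: cinner_norm)
  then show ?thesis
    unfolding of_real_eq_iff a_def .
qed

lemma Cauchy_Schwarz_cinner: "cmod (cinner x y) \<le> norm x * norm y"
proof (cases "y = 0")
  case False
  then have "(cmod (cinner x y))\<^sup>2 / (norm y)\<^sup>2 \<le> (norm x)\<^sup>2"
    using norm_diff_component_sq[of y x] by (metis diff_ge_0_iff_ge zero_le_power2)
  then have "(cmod (cinner x y))\<^sup>2 \<le> (norm x * norm y)\<^sup>2"
    using False by (simp add: field_simps power_mult_distrib)
  then show ?thesis
    by (rule power2_le_imp_le) simp
qed simp

interpretation cinner: bounded_bilinear "cinner :: 'a::complex_hilbert \<Rightarrow> 'a \<Rightarrow> complex"
  by (unfold_locales)
    (auto intro!: exI[of _ 1] simp: cinner_add_left cinner_add_right cinner_scaleR_left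
      cinner_scaleR_right Cauchy_Schwarz_cinner)

lemma norm_add_sq: "(norm (x + y))\<^sup>2 = (norm x)\<^sup>2 + 2 * Re (cinner x y) + (norm y)\<^sup>2"
  using Re_cinner_commute[of x y] by (simp add: norm_sq_cinner cinner_add_left cinner_add_right)

lemma norm_diff_sq: "(norm (x - y))\<^sup>2 = (norm x)\<^sup>2 - 2 * Re (cinner x y) + (norm y)\<^sup>2"
  using Re_cinner_commute[of x y] by (simp add: norm_sq_cinner cinner_diff_left cinner_diff_right)

lemma parallelogram_law:
  "(norm (x + y))\<^sup>2 + (norm (x - y))\<^sup>2 = 2 * (norm x)\<^sup>2 + 2 * (norm (y::'a::complex_hilbert))\<^sup>2"
  by (simp add: norm_add_sq norm_diff_sq)

lemma cinner_dense_eq_0: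
  assumes "closure D = UNIV" and "\<And>g. g \<in> D \<Longrightarrow> cinner x g = 0"
  shows "x = 0"
proof -
  obtain g where g: "\<And>n. g n \<in> D" "g \<longlonglongrightarrow> x"
    using assms(1) closure_sequential[of x D] by auto
  have "(\<lambda>n. cinner x (g n)) \<longlonglongrightarrow> cinner x x"
    using g(2) by (intro cinner.tendsto tendsto_const)
  then have "cinner x x = 0"
    using g(1) assms(2) by (simp add: LIMSEQ_const_iff)
  then show ?thesis by (simp add: cinner_norm)
qed

lemma norm_scaleC: "norm (a *\<^sub>C x) = cmod a * norm (x::'a::complex_hilbert)"
proof -
  have "complex_of_real ((norm (a *\<^sub>C x))\<^sup>2) = (a * cnj a) * cinner x x"
    unfolding cinner_norm[symmetric] by (simp add: cinner_scaleC_left cinner_scaleC_right)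
  also have "\<dots> = of_real ((cmod a * norm x)\<^sup>2)"
    by (simp add: cinner_norm power_mult_distrib flip: complex_norm_square)
  finally show ?thesis
    unfolding of_real_eq_iff by (simp add: power2_eq_iff_nonneg)
qed

lemma bounded_linear_scaleC: "bounded_linear (\<lambda>x::'a::complex_hilbert. a *\<^sub>C x)"
  by (rule bounded_linear_intro[of _ "cmod a"])
    (simp_all add: scaleC_add_right scaleR_scaleC scaleC_scaleC norm_scaleC mult.commute)

section \<open>Closed complex subspaces and orthogonal decomposition\<close>

definition csubspace :: "'a::complex_vector set \<Rightarrow> bool" where
  "csubspace M \<longleftrightarrow> 0 \<in> M \<and> (\<forall>x\<in>M. \<forall>y\<in>M. x + y \<in> M) \<and> (\<forall>a. \<forall>x\<in>M. a *\<^sub>C x \<in> M)"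

lemma csubspace_diff: "csubspace M \<Longrightarrow> x \<in> M \<Longrightarrow> y \<in> M \<Longrightarrow> x - y \<in> M"
  unfolding csubspace_def by (metis scaleC_minus_one add_uminus_conv_diff)

lemma csubspace_closure:
  fixes M :: "'a::complex_hilbert set"
  assumes "csubspace M"
  shows "csubspace (closure M)"
  unfolding csubspace_def
proof (intro conjI ballI allI)
  show "0 \<in> closure M" using assms closure_subset by (auto simp: csubspace_def)
  fix x assume "x \<in> closure M"
  then obtain X where X: "\<And>n. X n \<in> M" "X \<longlonglongrightarrow> x" by (auto simp: closure_sequential)
  { fix y assume "y \<in> closure M"
    then obtain Y where Y: "\<And>n. Y n \<in> M" "Y \<longlonglongrightarrow> y" by (auto simp: closure_sequential)
    show "x + y \<in> closure M"
      unfolding closure_sequential using X Y assms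
      by (intro exI[of _ "\<lambda>n. X n + Y n"]) (auto simp: csubspace_def intro: tendsto_add) }
  show "a *\<^sub>C x \<in> closure M" for a
    unfolding closure_sequential using X assms bounded_linear.tendsto[OF bounded_linear_scaleC X(2)]
    by (intro exI[of _ "\<lambda>n. a *\<^sub>C X n"]) (auto simp: csubspace_def)
qed

text \<open>A minimizing sequence is Cauchy: the midpoint of two near-minimizers stays in
  \<open>M\<close>, hence is at distance at least \<open>d\<close> from \<open>h\<close>, and the
  parallelogram law then leaves little room for their difference.\<close>

lemma closest_point_csubspace:
  fixes h :: "'a::complex_hilbert"
  assumes "closed M" and "csubspace M"
  obtains m where "m \<in> M" and "\<And>g. g \<in> M \<Longrightarrow> norm (h - m) \<le> norm (h - g)"
proof -
  have ne: "M \<noteq> {}" using assms(2) by (auto simp: csubspace_def)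
  define d where "d = infdist h M"
  have dle: "d \<le> norm (h - g)" if "g \<in> M" for g
    using infdist_le[OF that, of h] by (simp add: d_def dist_norm)
  have d0: "0 \<le> d" by (simp add: d_def infdist_nonneg)
  \<comment> \<open>The slack is put on the squared distance because the parallelogram law speaks of
    squares.\<close>
  have "\<exists>g\<in>M. (norm (h - g))\<^sup>2 < d\<^sup>2 + 1 / real (Suc n)" for n
  proof (rule ccontr)
    assume "\<not> ?thesis"
    then have *: "d\<^sup>2 + 1 / real (Suc n) \<le> (norm (h - g))\<^sup>2" if "g \<in> M" for g
      using that by (meson not_less)
    have "sqrt (d\<^sup>2 + 1 / real (Suc n)) \<le> dist h g" if "g \<in> M" for g
      using *[OF that] by (intro real_le_lsqrt) (auto simp: dist_norm)
    then have "sqrt (d\<^sup>2 + 1 / real (Suc n)) \<le> (INF g\<in>M. dist h g)"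
      using ne by (intro cINF_greatest)
    then have "sqrt (d\<^sup>2 + 1 / real (Suc n)) \<le> d"
      by (simp only: d_def infdist_notempty[OF ne])
    moreover have "d < sqrt (d\<^sup>2 + 1 / real (Suc n))"
      by (rule real_less_rsqrt) simp
    ultimately show False by simp
  qed
  then obtain m where m: "\<And>n. m n \<in> M" "\<And>n. (norm (h - m n))\<^sup>2 < d\<^sup>2 + 1 / real (Suc n)"
    by metis
  have close: "(norm (m i - m j))\<^sup>2 \<le> 2 / real (Suc i) + 2 / real (Suc j)" for i j
  proof -
    have "(1/2) *\<^sub>R (m i + m j) \<in> M"
      using assms(2) m(1) by (simp add: csubspace_def scaleR_scaleC)
    then have "d \<le> norm (h - (1/2) *\<^sub>R (m i + m j))" by (rule dle)
    also have "\<dots> = norm ((1/2) *\<^sub>R ((h - m i) + (h - m j)))"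
      by (rule arg_cong[where f=norm]) (simp add: algebra_simps flip: scaleR_left_distrib)
    finally have "2 * d \<le> norm ((h - m i) + (h - m j))" by simp
    then have "(2 * d)\<^sup>2 \<le> (norm ((h - m i) + (h - m j)))\<^sup>2"
      using d0 by (intro power_mono) auto
    moreover have "norm (m i - m j) = norm ((h - m i) - (h - m j))"
      by (simp add: norm_minus_commute)
    ultimately show ?thesis
      using parallelogram_law[of "h - m i" "h - m j"] m(2)[of i] m(2)[of j]
      by (simp add: power_mult_distrib)
  qed
  have "Cauchy m"
  proof (rule metric_CauchyI)
    fix e :: real assume "0 < e"
    then obtain N where N: "inverse (real (Suc N)) < e\<^sup>2 / 4"
      using reals_Archimedean[of "e\<^sup>2 / 4"] by auto
    have "dist (m i) (m j) < e" if "i \<ge> N" "j \<ge> N" for i j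
    proof -
      have "(norm (m i - m j))\<^sup>2 \<le> 2 / real (Suc i) + 2 / real (Suc j)" by (rule close)
      also have "\<dots> \<le> 2 / real (Suc N) + 2 / real (Suc N)"
        using that by (intro add_mono divide_left_mono) auto
      also have "\<dots> = 4 * inverse (real (Suc N))" by (simp add: divide_inverse)
      also have "\<dots> < e\<^sup>2" using N by simp
      finally show ?thesis
        unfolding dist_norm using \<open>0 < e\<close> power2_less_imp_less by (metis less_imp_le)
    qed
    then show "\<exists>N. \<forall>i\<ge>N. \<forall>j\<ge>N. dist (m i) (m j) < e" by blast
  qed
  then obtain x where x: "m \<longlonglongrightarrow> x"
    using Cauchy_convergent convergent_def by blast
  have "(\<lambda>n. (norm (h - m n))\<^sup>2) \<longlonglongrightarrow> (norm (h - x))\<^sup>2"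
    using x by (intro tendsto_intros)
  moreover have "(\<lambda>n. d\<^sup>2 + 1 / real (Suc n)) \<longlonglongrightarrow> d\<^sup>2 + 0"
    by (intro tendsto_add tendsto_const LIMSEQ_Suc[OF lim_1_over_n])
  ultimately have "(norm (h - x))\<^sup>2 \<le> d\<^sup>2 + 0"
    by (rule LIMSEQ_le) (intro exI allI impI less_imp_le m(2))
  then have "norm (h - x) \<le> d"
    using d0 by (metis add_0_right power2_le_imp_le)
  moreover have "x \<in> M"
    using assms(1) m(1) x closed_sequentially by blast
  ultimately show ?thesis
    using that dle by (meson order_trans)
qed

text \<open>Otherwise moving the closest point \<open>m\<close> by the component of
  \<open>h - m\<close> along \<open>g\<close> would bring it strictly closer to
  \<open>h\<close>.\<close>

lemma orthogonal_decomposition: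
  fixes h :: "'a::complex_hilbert"
  assumes "closed M" and "csubspace M"
  obtains m where "m \<in> M" and "\<And>g. g \<in> M \<Longrightarrow> cinner (h - m) g = 0"
proof -
  obtain m where m: "m \<in> M" "\<And>g. g \<in> M \<Longrightarrow> norm (h - m) \<le> norm (h - g)"
    using closest_point_csubspace[OF assms] by blast
  have "cinner (h - m) g = 0" if g: "g \<in> M" for g
  proof (cases "g = 0")
    case False
    define a where "a = cinner (h - m) g / of_real ((norm g)\<^sup>2)"
    have "m + a *\<^sub>C g \<in> M" using assms(2) m(1) g by (simp add: csubspace_def)
    then have "norm (h - m) \<le> norm ((h - m) - a *\<^sub>C g)"
      using m(2) by (simp add: diff_diff_add)
    then have "(norm (h - m))\<^sup>2 \<le> (norm ((h - m) - a *\<^sub>C g))\<^sup>2" by (intro power_mono) auto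
    then have "(cmod (cinner (h - m) g))\<^sup>2 / (norm g)\<^sup>2 \<le> 0"
      unfolding a_def norm_diff_component_sq[OF False] by simp
    then show ?thesis using False by (simp add: divide_le_0_iff)
  qed simp
  with m(1) show ?thesis using that by blast
qed

text \<open>Graphs of operators become subspaces of a Hilbert space, so that orthogonal
  decomposition applies to them. The product norm is Euclidean, which is what
  \<open>cinner_norm\<close> demands of the sum of the two inner products.\<close>

instantiation prod :: (complex_hilbert, complex_hilbert) complex_hilbert
begin
definition "scaleC a x = (a *\<^sub>C fst x, a *\<^sub>C snd x)"
definition "cinner x y = cinner (fst x) (fst y) + cinner (snd x) (snd y)"
instance
proof
  fix x y z :: "'a \<times> 'b" and a b :: complex and r :: real
  show "a *\<^sub>C (x + y) = a *\<^sub>C x + a *\<^sub>C y"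
    by (simp add: scaleC_prod_def scaleC_add_right)
  show "(a + b) *\<^sub>C x = a *\<^sub>C x + b *\<^sub>C x"
    by (simp add: scaleC_prod_def scaleC_add_left)
  show "a *\<^sub>C b *\<^sub>C x = (a * b) *\<^sub>C x"
    by (simp add: scaleC_prod_def scaleC_scaleC)
  show "1 *\<^sub>C x = x"
    by (simp add: scaleC_prod_def scaleC_one)
  show "r *\<^sub>R x = complex_of_real r *\<^sub>C x"
    by (simp add: scaleC_prod_def scaleR_prod_def scaleR_scaleC)
  show "cinner x y = cnj (cinner y x)"
    using cinner_commute[of "fst x" "fst y"] cinner_commute[of "snd x" "snd y"]
    by (simp add: cinner_prod_def)
  show "cinner (x + y) z = cinner x z + cinner y z"
    by (simp add: cinner_prod_def cinner_add_left)
  show "cinner (a *\<^sub>C x) y = a * cinner x y"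
    by (simp add: cinner_prod_def scaleC_prod_def cinner_scaleC_left distrib_left)
  show "cinner x x = complex_of_real ((norm x)\<^sup>2)"
    by (simp add: cinner_prod_def cinner_norm norm_prod_def)
qed
end

section \<open>Adjoints and the modulus\<close>

lemma linear_op_zero: "linear_op A \<Longrightarrow> A 0 = Some 0"
  and linear_op_add: "linear_op A \<Longrightarrow> A f = Some u \<Longrightarrow> A g = Some v \<Longrightarrow> A (f + g) = Some (u + v)"
  and linear_op_scaleC: "linear_op A \<Longrightarrow> A f = Some u \<Longrightarrow> A (a *\<^sub>C f) = Some (a *\<^sub>C u)"
  by (simp_all add: linear_op_def)

lemma linear_op_diff:
  assumes "linear_op A" "A f = Some u" "A g = Some v"
  shows "A (f - g) = Some (u - v)"
  using linear_op_add[OF assms(1,2) linear_op_scaleC[OF assms(1,3), of "-1"]]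
  by (simp add: scaleC_minus_one)

text \<open>Density makes the representing vector unique, which eliminates the \<open>THE\<close> in
  \<open>adjoint_op\<close>.\<close>

lemma adjoint_op_eq_Some_iff:
  assumes "densely_defined A"
  shows "adjoint_op A g = Some h \<longleftrightarrow> (\<forall>f u. A f = Some u \<longrightarrow> cinner u g = cinner f h)"
proof -
  define Q where "Q h \<longleftrightarrow> (\<forall>f\<in>dom A. cinner (the (A f)) g = cinner f h)" for h
  have uniq: "h = h'" if "Q h" "Q h'" for h h'
  proof -
    have "cinner (h - h') f = 0" if "f \<in> dom A" for f
      using \<open>Q h\<close> \<open>Q h'\<close> that cinner_commute[of h f] cinner_commute[of h' f]
      by (simp add: Q_def cinner_diff_left)
    then show ?thesis
      using assms cinner_dense_eq_0[of "dom A" "h - h'"] by (simp add: densely_defined_def)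
  qed
  have "adjoint_op A g = (if \<exists>h. Q h then Some (THE h. Q h) else None)"
    by (simp add: adjoint_op_def Q_def)
  then have "adjoint_op A g = Some h \<longleftrightarrow> Q h"
    using uniq by (metis option.distinct(1) option.inject the_equality)
  then show ?thesis by (auto simp: Q_def dom_def)
qed

lemma closed_op_limit:
  assumes "closed_op A" "\<And>n. A (f n) = Some (u n)" "f \<longlonglongrightarrow> x" "u \<longlonglongrightarrow> y"
  shows "A x = Some y"
proof -
  have "(\<lambda>n. (f n, u n)) \<longlonglongrightarrow> (x, y)" using assms(3,4) by (rule tendsto_Pair)
  moreover have "(f n, u n) \<in> Map.graph A" for n
    using assms(2) by (simp add: Map.graph_def)
  ultimately have "(x, y) \<in> Map.graph A"
    using assms(1) unfolding closed_op_def by (meson closed_sequentially)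
  then show ?thesis by (simp add: Map.graph_def)
qed

lemma csubspace_graph: "linear_op A \<Longrightarrow> csubspace (Map.graph A)"
  by (auto simp: csubspace_def Map.graph_def linear_op_def scaleC_prod_def zero_prod_def)

lemma selfadjoint_op_symmetric:
  assumes "selfadjoint_op B" "B f = Some u" "B g = Some v"
  shows "cinner u g = cinner f v"
  using assms adjoint_op_eq_Some_iff[of B g v] by (simp add: selfadjoint_op_def)

text \<open>The graph of \<open>B\<close> is that of its adjoint, which is cut out by equations
  continuous in the pair.\<close>

lemma selfadjoint_op_closed:
  assumes "selfadjoint_op B"
  shows "closed_op B"
  unfolding closed_op_def closed_sequential_limits
proof (intro allI impI, elim conjE)
  fix z l assume z: "\<forall>n. z n \<in> Map.graph B" and l: "z \<longlonglongrightarrow> l"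
  have B: "B (fst (z n)) = Some (snd (z n))" for n
    using z by (auto simp: Map.graph_def dest!: spec[of _ n])
  have "cinner u (fst l) = cinner f (snd l)" if "B f = Some u" for f u
  proof (rule LIMSEQ_unique)
    show "(\<lambda>n. cinner u (fst (z n))) \<longlonglongrightarrow> cinner u (fst l)"
      using l by (intro cinner.tendsto tendsto_const tendsto_fst)
    show "(\<lambda>n. cinner u (fst (z n))) \<longlonglongrightarrow> cinner f (snd l)"
      unfolding selfadjoint_op_symmetric[OF assms that B]
      using l by (intro cinner.tendsto tendsto_const tendsto_snd)
  qed
  then have "B (fst l) = Some (snd l)"
    using assms adjoint_op_eq_Some_iff[of B "fst l" "snd l"] by (simp add: selfadjoint_op_def)
  then show "l \<in> Map.graph B" by (cases l) (simp add: Map.graph_def)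
qed

text \<open>Project \<open>(h, 0)\<close> orthogonally onto the graph of \<open>A\<close>.\<close>

lemma surj_one_plus_adjoint_comp:
  assumes A: "linear_op A" "closed_op A" "densely_defined A"
  obtains f u w where "A f = Some u" "adjoint_op A u = Some w" "f + w = h"
proof -
  obtain m where m: "m \<in> Map.graph A"
    "\<And>z. z \<in> Map.graph A \<Longrightarrow> cinner ((h, 0) - m) z = 0"
    using orthogonal_decomposition[OF A(2)[unfolded closed_op_def] csubspace_graph[OF A(1)]] by blast
  obtain f u where fu: "m = (f, u)" by (cases m)
  have "A f = Some u" using m(1) by (simp add: fu Map.graph_def)
  \<comment> \<open>Orthogonality of the residual \<open>(h - f, - u)\<close> to the graph is the
    defining equation of the adjoint at \<open>u\<close>.\<close>
  moreover have "adjoint_op A u = Some (h - f)"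
    unfolding adjoint_op_eq_Some_iff[OF A(3)]
  proof (intro allI impI)
    fix g v assume "A g = Some v"
    then have "cinner (h - f) g - cinner u v = 0"
      using m(2)[of "(g, v)"]
      by (simp add: fu Map.graph_def cinner_prod_def cinner.minus_left)
    then show "cinner v u = cinner g (h - f)"
      by (metis cinner_commute eq_iff_diff_eq_0)
  qed
  ultimately show ?thesis using that by simp
qed

text \<open>\<open>G\<close> is the graph of \<open>A\<close> restricted to the domain of
  \<open>adjoint_op A \<circ>\<^sub>m A\<close>. The residual \<open>(k, l)\<close> of
  \<open>(f, u)\<close> over the closure of \<open>G\<close> lies in the graph of \<open>A\<close>
  and is orthogonal to every \<open>(g, v)\<close> in \<open>G\<close>, which says that
  \<open>k\<close> is orthogonal to \<open>g + w\<close> with \<open>w\<close> the value of the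
  adjoint at \<open>v\<close>. Such sums exhaust the space, so \<open>k\<close> itself is one of
  them and vanishes.\<close>

lemma adjoint_comp_core:
  assumes A: "linear_op A" "closed_op A" "densely_defined A" and f: "A f = Some u"
  obtains g v w where "\<And>n. A (g n) = Some (v n)" "\<And>n. adjoint_op A (v n) = Some (w n)"
    "g \<longlonglongrightarrow> f" "v \<longlonglongrightarrow> u"
proof -
  define G where "G = {(g, v). A g = Some v \<and> v \<in> dom (adjoint_op A)}"
  note adj = adjoint_op_eq_Some_iff[OF A(3)]
  have "adjoint_op A 0 = Some 0" by (simp add: adj)
  moreover have "adjoint_op A (x + y) = Some (p + q)"
    if "adjoint_op A x = Some p" "adjoint_op A y = Some q" for x y p q
    using that by (simp add: adj cinner_add_right)
  moreover have "adjoint_op A (a *\<^sub>C x) = Some (a *\<^sub>C p)"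
    if "adjoint_op A x = Some p" for a x p
    using that by (simp add: adj cinner_scaleC_right)
  ultimately have G: "csubspace G"
    using A(1) by (auto simp: csubspace_def G_def linear_op_def scaleC_prod_def zero_prod_def dom_def)
  have "G \<subseteq> Map.graph A" by (auto simp: G_def Map.graph_def)
  then have clG: "closure G \<subseteq> Map.graph A"
    using A(2) by (simp add: closed_op_def closure_minimal)
  obtain m where m: "m \<in> closure G" "\<And>z. z \<in> closure G \<Longrightarrow> cinner ((f, u) - m) z = 0"
    using orthogonal_decomposition[OF closed_closure csubspace_closure[OF G]] by blast
  obtain k l where kl: "(f, u) - m = (k, l)" by (cases "(f, u) - m")
  have "(k, l) \<in> Map.graph A"
    unfolding kl[symmetric] using f m(1) clG
    by (intro csubspace_diff csubspace_graph A) (auto simp: Map.graph_def)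
  then have k: "A k = Some l" by (simp add: Map.graph_def)
  obtain g v w where g: "A g = Some v" "adjoint_op A v = Some w" "g + w = k"
    using surj_one_plus_adjoint_comp[OF A] by blast
  have "(g, v) \<in> G" using g by (auto simp: G_def)
  then have "cinner (k, l) (g, v) = 0"
    using m(2)[of "(g, v)"] closure_subset[of G] unfolding kl by blast
  moreover have "cinner l v = cinner k w" using g(2) k by (simp add: adj)
  ultimately have "cinner k k = 0"
    by (simp add: cinner_prod_def cinner_add_right flip: g(3))
  then have "k = 0" by (simp add: cinner_norm)
  with k linear_op_zero[OF A(1)] have "l = 0" by simp
  with kl \<open>k = 0\<close> have "(f, u) \<in> closure G" using m(1) by (simp add: prod_eq_iff)
  then obtain X where X: "\<And>n. X n \<in> G" "X \<longlonglongrightarrow> (f, u)" by (auto simp: closure_sequential)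
  have "\<forall>n. \<exists>w. A (fst (X n)) = Some (snd (X n)) \<and> adjoint_op A (snd (X n)) = Some w"
    using X(1) by (simp add: G_def case_prod_beta dom_def)
  then obtain w where "\<forall>n. A (fst (X n)) = Some (snd (X n)) \<and> adjoint_op A (snd (X n)) = Some (w n)"
    by metis
  then show ?thesis
    using tendsto_fst[OF X(2)] tendsto_snd[OF X(2)] by (intro that[of "\<lambda>n. fst (X n)" "\<lambda>n. snd (X n)" w]) auto
qed

text \<open>On the core, inner products of values of \<open>A\<close> are determined by
  \<open>adjoint_op A \<circ>\<^sub>m A\<close>, hence agree with those of \<open>B\<close>. So
  \<open>A g \<mapsto> B g\<close> is isometric there, carries Cauchy sequences to Cauchy sequences,
  and closedness of \<open>B\<close> extends this to all of the domain of \<open>A\<close>.\<close>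

lemma adjoint_comp_eq_imp:
  assumes A: "linear_op A" "closed_op A" "densely_defined A"
    and B: "linear_op B" "closed_op B" "densely_defined B"
    and eq: "adjoint_op A \<circ>\<^sub>m A = adjoint_op B \<circ>\<^sub>m B" and f: "A f = Some u"
  obtains u' where "B f = Some u'" "norm u' = norm u"
proof -
  obtain g v w where g: "\<And>n. A (g n) = Some (v n)" "\<And>n. adjoint_op A (v n) = Some (w n)"
    "g \<longlonglongrightarrow> f" "v \<longlonglongrightarrow> u"
    using adjoint_comp_core[OF A f] by blast
  have "\<forall>n. \<exists>v'. B (g n) = Some v' \<and> adjoint_op B v' = Some (w n)"
  proof
    fix n
    have "(adjoint_op B \<circ>\<^sub>m B) (g n) = Some (w n)"
      unfolding eq[symmetric] by (simp add: map_comp_def g)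
    then show "\<exists>v'. B (g n) = Some v' \<and> adjoint_op B v' = Some (w n)"
      by (auto simp: map_comp_def split: option.splits)
  qed
  then obtain v' where v': "\<And>n. B (g n) = Some (v' n)" "\<And>n. adjoint_op B (v' n) = Some (w n)"
    by metis
  have same: "cinner (v m) (v n) = cinner (v' m) (v' n)" for m n
    using g(1)[of m] v'(1)[of m] g(2)[of n] v'(2)[of n]
    by (simp add: adjoint_op_eq_Some_iff[OF A(3)] adjoint_op_eq_Some_iff[OF B(3)])
  have "cinner (v m - v n) (v m - v n) = cinner (v' m - v' n) (v' m - v' n)" for m n
    by (simp add: cinner_diff_left cinner_diff_right same)
  then have dist: "dist (v m) (v n) = dist (v' m) (v' n)" for m n
    by (simp add: cinner_norm dist_norm power2_eq_iff_nonneg del: of_real_power)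
  have nrm: "norm (v n) = norm (v' n)" for n
    using same[of n n] by (simp add: cinner_norm power2_eq_iff_nonneg del: of_real_power)
  have "Cauchy v'"
    using LIMSEQ_imp_Cauchy[OF g(4)] by (simp add: Cauchy_def dist)
  then obtain u' where u': "v' \<longlonglongrightarrow> u'" using Cauchy_convergent convergent_def by blast
  have "B f = Some u'" by (rule closed_op_limit[OF B(2) v'(1) g(3) u'])
  moreover have "norm u' = norm u"
    using LIMSEQ_unique[OF tendsto_norm[OF u'] tendsto_norm[OF g(4), unfolded nrm]] .
  ultimately show ?thesis using that by blast
qed

text \<open>\<open>B\<close> is its own adjoint, so \<open>B \<circ>\<^sub>m B\<close> is also
  \<open>adjoint_op B \<circ>\<^sub>m B\<close> and the comparison runs in both directions.\<close>

lemma modulus_dom_norm: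
  assumes A: "linear_op A" "closed_op A" "densely_defined A" and B: "is_modulus A B"
  shows "dom B = dom A" and "\<And>f. norm (the (B f)) = norm (the (A f))"
proof -
  have sa: "selfadjoint_op B" and BB: "B \<circ>\<^sub>m B = adjoint_op A \<circ>\<^sub>m A" using B by (auto simp: is_modulus_def)
  have B': "linear_op B" "closed_op B" "densely_defined B"
    using sa selfadjoint_op_closed by (auto simp: selfadjoint_op_def)
  have eq: "adjoint_op A \<circ>\<^sub>m A = adjoint_op B \<circ>\<^sub>m B"
    using sa BB by (simp add: selfadjoint_op_def)
  note AB = adjoint_comp_eq_imp[OF A B' eq] and BA = adjoint_comp_eq_imp[OF B' A eq[symmetric]]
  have "f \<in> dom A \<longleftrightarrow> f \<in> dom B" for f
    using AB[of f] BA[of f] by (metis domD domI)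
  then show dom: "dom B = dom A" by blast
  show "norm (the (B f)) = norm (the (A f))" for f
  proof (cases "f \<in> dom A")
    case True
    then obtain u where u: "A f = Some u" by blast
    from AB[OF u] show ?thesis using u by (metis option.sel)
  next
    case False
    \<comment> \<open>Outside the common domain both sides are \<open>norm (the None)\<close>, so
      the equality of norms carries no domain condition.\<close>
    then have "A f = None" "B f = None" using dom by auto
    then show ?thesis by simp
  qed
qed

section \<open>Projection-valued measures\<close>

context
  fixes P :: "'a::complex_hilbert \<Rightarrow> 'a"
  assumes P: "orthogonal_projection P"
begin

lemma proj_add: "P (f + g) = P f + P g"
  and proj_scaleC: "P (a *\<^sub>C f) = a *\<^sub>C P f"
  and proj_idem: "P (P f) = P f"
  and proj_selfadjoint: "cinner (P f) g = cinner f (P g)"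
  using P by (simp_all add: orthogonal_projection_def)

lemma proj_diff: "P (f - g) = P f - P g"
  using proj_add[of "f - g" g] by simp

lemma cinner_proj_self: "cinner (P f) f = of_real ((norm (P f))\<^sup>2)"
  by (metis cinner_norm proj_idem proj_selfadjoint)

lemma norm_diff_proj_sq: "(norm (f - P f))\<^sup>2 = (norm f)\<^sup>2 - (norm (P f))\<^sup>2"
  using cinner_proj_self[of f] Re_cinner_commute[of f "P f"] by (simp add: norm_diff_sq)

lemma norm_proj_le: "norm (P f) \<le> norm f"
  using norm_diff_proj_sq[of f] by (metis diff_ge_0_iff_ge norm_ge_zero power2_le_imp_le zero_le_power2)

lemma proj_eq_self: "norm (P f) = norm f \<Longrightarrow> P f = f"
  using norm_diff_proj_sq[of f] by simp

end

text \<open>Fixed points are the range. Equal ranges give PQ = Q and QP = P; taking adjoints in the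
  first gives QP = Q.\<close>

lemma proj_eqI:
  assumes P: "orthogonal_projection P" and Q: "orthogonal_projection Q"
    and fixpoints: "\<And>f. P f = f \<longleftrightarrow> Q f = f"
  shows "P f = Q f"
proof -
  have "P (Q f) = Q f" for f using proj_idem[OF Q] fixpoints by blast
  then have "cinner (Q (P f)) g = cinner (Q f) g" for f g
    by (simp add: proj_selfadjoint[OF P] proj_selfadjoint[OF Q])
  then have "cinner (Q (P f) - Q f) g = 0" for f g by (simp add: cinner_diff_left)
  then have "Q (P f) = Q f" by (metis cinner_dense_eq_0 closure_UNIV eq_iff_diff_eq_0)
  moreover have "Q (P f) = P f" using proj_idem[OF P] fixpoints by blast
  ultimately show ?thesis by simp
qed

text \<open>If \<open>P + Q\<close> is a contraction, then \<open>\<parallel>P f + Q P f\<parallel>\<^sup>2 = \<parallel>P f\<parallel>\<^sup>2 + 3 \<parallel>Q P f\<parallel>\<^sup>2\<close> is at most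
  \<open>\<parallel>P f\<parallel>\<^sup>2\<close>.\<close>

lemma proj_orthogonal:
  assumes P: "orthogonal_projection P" and Q: "orthogonal_projection Q"
    and R: "orthogonal_projection R" and sum: "\<And>f. R f = P f + Q f"
  shows "Q (P f) = 0"
proof -
  have "norm (P f + Q (P f)) \<le> norm (P f)"
    using norm_proj_le[OF R, of "P f"] by (simp add: sum proj_idem[OF P])
  then have "(norm (P f + Q (P f)))\<^sup>2 \<le> (norm (P f))\<^sup>2" by (intro power_mono) auto
  moreover have "Re (cinner (P f) (Q (P f))) = (norm (Q (P f)))\<^sup>2"
    using cinner_proj_self[OF Q, of "P f"] Re_cinner_commute[of "P f"] by simp
  ultimately show ?thesis by (simp add: norm_add_sq)
qed

lemma sets_borel_Rplus: "\<sigma> \<in> sets borel_Rplus \<longleftrightarrow> \<sigma> \<in> sets borel \<and> \<sigma> \<subseteq> {0..}"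
  by (subst sets_restrict_space_iff) auto

locale projection_valued_measure =
  fixes E :: "real set \<Rightarrow> 'a::complex_hilbert \<Rightarrow> 'a"
  assumes spectral_measure: "spectral_measure E"
begin

lemma projection: "\<sigma> \<in> sets borel_Rplus \<Longrightarrow> orthogonal_projection (E \<sigma>)"
  and E_space: "E {0..} f = f"
  and E_sums: "range S \<subseteq> sets borel_Rplus \<Longrightarrow> disjoint_family S
    \<Longrightarrow> (\<lambda>n. E (S n) f) sums E (\<Union>n. S n) f"
  using spectral_measure by (auto simp: spectral_measure_def)

text \<open>The empty set is a countable disjoint union of copies of itself, and a constant series
  converges only if its terms vanish.\<close>

lemma E_empty: "E {} f = 0"
proof -
  have "(\<lambda>n. E {} f) sums E (\<Union>n::nat. {}) f"
    by (rule E_sums) (auto simp: disjoint_family_on_def)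
  then show ?thesis
    using summable_const_iff[of "E {} f"] sums_summable by blast
qed

lemma E_Un:
  assumes "\<sigma> \<in> sets borel_Rplus" "\<tau> \<in> sets borel_Rplus" "\<sigma> \<inter> \<tau> = {}"
  shows "E (\<sigma> \<union> \<tau>) f = E \<sigma> f + E \<tau> f"
proof -
  have "range (binaryset \<sigma> \<tau>) \<subseteq> sets borel_Rplus"
    using assms sets.empty_sets[of borel_Rplus] by (auto simp: range_binaryset_eq)
  moreover have "disjoint_family (binaryset \<sigma> \<tau>)"
    using assms(3) by (auto simp: disjoint_family_on_def binaryset_def)
  ultimately have "(\<lambda>n. E (binaryset \<sigma> \<tau> n) f) sums E (\<sigma> \<union> \<tau>) f"
    using E_sums[of "binaryset \<sigma> \<tau>" f] by (simp add: UN_binaryset_eq)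
  moreover have "(\<lambda>n. E (binaryset \<sigma> \<tau> n) f) sums (E \<sigma> f + E \<tau> f)"
    by (rule binaryset_sums[where f="\<lambda>\<sigma>. E \<sigma> f"]) (rule E_empty)
  ultimately show ?thesis by (rule sums_unique2)
qed

lemma E_compl:
  assumes "\<sigma> \<in> sets borel_Rplus"
  shows "{0..} - \<sigma> \<in> sets borel_Rplus" and "E ({0..} - \<sigma>) f = f - E \<sigma> f"
proof -
  show *: "{0..} - \<sigma> \<in> sets borel_Rplus" using assms by (auto simp: sets_borel_Rplus)
  have "\<sigma> \<union> ({0..} - \<sigma>) = {0..}" using assms by (auto simp: sets_borel_Rplus)
  then have "f = E \<sigma> f + E ({0..} - \<sigma>) f"
    using E_Un[OF assms *, of f] E_space[of f] by auto
  then show "E ({0..} - \<sigma>) f = f - E \<sigma> f" by (metis add_diff_cancel_left')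
qed

lemma E_disjoint:
  assumes "\<sigma> \<in> sets borel_Rplus" "\<tau> \<in> sets borel_Rplus" "\<sigma> \<inter> \<tau> = {}"
  shows "E \<sigma> (E \<tau> f) = 0"
  using assms E_Un[of \<tau> \<sigma>]
  by (intro proj_orthogonal[of "E \<tau>" "E \<sigma>" "E (\<tau> \<union> \<sigma>)"]) (auto intro!: projection)

text \<open>\<open>spectral_measure\<close> postulates projections and additivity; multiplicativity
  is derived from them, since after cutting both sets along their intersection all products over
  disjoint pieces vanish.\<close>

lemma E_Int:
  assumes s: "\<sigma> \<in> sets borel_Rplus" and t: "\<tau> \<in> sets borel_Rplus"
  shows "E \<sigma> (E \<tau> f) = E (\<sigma> \<inter> \<tau>) f"
proof -
  have st: "\<sigma> \<inter> \<tau> \<in> sets borel_Rplus" "\<sigma> - \<tau> \<in> sets borel_Rplus" "\<tau> - \<sigma> \<in> sets borel_Rplus"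
    using s t by auto
  have eq: "(\<sigma> \<inter> \<tau>) \<union> (\<tau> - \<sigma>) = \<tau>" "(\<sigma> \<inter> \<tau>) \<union> (\<sigma> - \<tau>) = \<sigma>" by auto
  have tau: "E \<tau> f = E (\<sigma> \<inter> \<tau>) f + E (\<tau> - \<sigma>) f"
    using E_Un[OF st(1,3), of f] unfolding eq by blast
  have sig: "E \<sigma> g = E (\<sigma> \<inter> \<tau>) g + E (\<sigma> - \<tau>) g" for g
    using E_Un[OF st(1,2), of g] unfolding eq by blast
  have "E \<sigma> (E \<tau> f) = E \<sigma> (E (\<sigma> \<inter> \<tau>) f) + E \<sigma> (E (\<tau> - \<sigma>) f)"
    by (simp add: tau proj_add[OF projection[OF s]])
  also have "E \<sigma> (E (\<tau> - \<sigma>) f) = 0"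
    by (rule E_disjoint) (use s st in auto)
  also have "E \<sigma> (E (\<sigma> \<inter> \<tau>) f) = E (\<sigma> \<inter> \<tau>) (E (\<sigma> \<inter> \<tau>) f) + E (\<sigma> - \<tau>) (E (\<sigma> \<inter> \<tau>) f)"
    by (rule sig)
  also have "E (\<sigma> - \<tau>) (E (\<sigma> \<inter> \<tau>) f) = 0"
    by (rule E_disjoint) (use st in auto)
  finally show ?thesis using proj_idem[OF projection[OF st(1)]] by simp
qed

lemma sets_scalar_measure [measurable_cong]: "sets (scalar_measure E f) = sets borel_Rplus"
  and space_scalar_measure [simp]: "space (scalar_measure E f) = {0..}"
proof -
  have sub: "sets borel_Rplus \<subseteq> Pow {0..}" by (auto simp: sets_borel_Rplus)
  show "space (scalar_measure E f) = {0..}"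
    by (simp add: scalar_measure_def space_measure_of[OF sub])
  show "sets (scalar_measure E f) = sets borel_Rplus"
    using sets.sigma_sets_eq[of borel_Rplus]
    by (simp add: scalar_measure_def sets_measure_of[OF sub] space_restrict_space)
qed

text \<open>\<open>measure_of\<close> yields the intended values only for a positive, countably
  additive set function, so this is where \<open>scalar_measure\<close> is shown to be the measure
  it is meant to be.\<close>

lemma emeasure_scalar_measure:
  assumes "\<sigma> \<in> sets borel_Rplus"
  shows "emeasure (scalar_measure E f) \<sigma> = ennreal ((norm (E \<sigma> f))\<^sup>2)"
proof -
  let ?\<mu> = "\<lambda>\<sigma>. ennreal (Re (cinner (E \<sigma> f) f))"
  have nn: "0 \<le> Re (cinner (E \<sigma> f) f)" if "\<sigma> \<in> sets borel_Rplus" for \<sigma>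
    by (simp add: cinner_proj_self[OF projection[OF that]])
  have "emeasure (scalar_measure E f) \<sigma> = ?\<mu> \<sigma>"
  proof (rule emeasure_measure_of[OF scalar_measure_def])
    show "sets borel_Rplus \<subseteq> Pow {0..}" by (auto simp: sets_borel_Rplus)
    show "positive (sets (scalar_measure E f)) ?\<mu>" by (simp add: positive_def E_empty)
    show "countably_additive (sets (scalar_measure E f)) ?\<mu>"
    proof (rule countably_additiveI)
      fix S :: "nat \<Rightarrow> real set"
      assume S: "range S \<subseteq> sets (scalar_measure E f)" "disjoint_family S"
      \<comment> \<open>A bounded functional carries additivity in the strong topology to the scalar
        series.\<close>
      have "bounded_linear (\<lambda>x. Re (cinner x f))"
        by (rule bounded_linear_compose[OF bounded_linear_Re cinner.bounded_linear_left])
      from bounded_linear.sums[OF this E_sums] S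
      have "(\<lambda>n. Re (cinner (E (S n) f) f)) sums Re (cinner (E (\<Union>n. S n) f) f)"
        by (simp add: sets_scalar_measure)
      then show "(\<Sum>n. ?\<mu> (S n)) = ?\<mu> (\<Union>n. S n)"
        using S(1) nn by (intro suminf_ennreal_eq) (auto simp: sets_scalar_measure)
    qed
    show "\<sigma> \<in> sets (scalar_measure E f)" using assms by (simp add: sets_scalar_measure)
  qed
  then show ?thesis by (simp add: cinner_proj_self[OF projection[OF assms]])
qed

lemma finite_measure_scalar_measure: "finite_measure (scalar_measure E f)"
  by (rule finite_measureI) (simp add: emeasure_scalar_measure sets_borel_Rplus)

lemma measure_space_scalar_measure: "measure (scalar_measure E f) {0..} = (norm f)\<^sup>2"
  by (simp add: measure_def emeasure_scalar_measure sets_borel_Rplus E_space)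

lemma AE_scalar_measure:
  assumes "\<sigma> \<in> sets borel_Rplus" and "E \<sigma> f = f"
  shows "AE t in scalar_measure E f. t \<in> \<sigma>"
proof (rule AE_I')
  show "{0..} - \<sigma> \<in> null_sets (scalar_measure E f)"
    using E_compl(1)[OF assms(1)] E_compl(2)[OF assms(1), of f] assms(2)
    by (simp add: null_sets_def sets_scalar_measure emeasure_scalar_measure)
qed auto

text \<open>This is multiplicativity of \<open>E\<close> in terms of measures: integrals for
  \<open>E \<sigma> f\<close> become integrals for \<open>f\<close> over \<sigma>. The density is
  \<open>ennreal\<close> of a real indicator so that it serves Bochner integrals as well.\<close>

lemma scalar_measure_proj:
  assumes s: "\<sigma> \<in> sets borel_Rplus"
  shows "scalar_measure E (E \<sigma> f) = density (scalar_measure E f) (\<lambda>t. ennreal (indicat_real \<sigma> t))"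
proof (rule measure_eqI)
  fix \<tau> assume "\<tau> \<in> sets (scalar_measure E (E \<sigma> f))"
  then have t: "\<tau> \<in> sets borel_Rplus" by (simp add: sets_scalar_measure)
  have "emeasure (density (scalar_measure E f) (\<lambda>t. ennreal (indicat_real \<sigma> t))) \<tau>
      = (\<integral>\<^sup>+ t. indicator (\<tau> \<inter> \<sigma>) t \<partial>scalar_measure E f)"
  proof -
    have "ennreal (indicat_real \<sigma> t) * indicator \<tau> t = indicator (\<tau> \<inter> \<sigma>) t" for t
      by (simp split: split_indicator)
    moreover have "(\<lambda>t. ennreal (indicat_real \<sigma> t)) \<in> borel_measurable (scalar_measure E f)"
      using s by (simp add: sets_scalar_measure)
    ultimately show ?thesis
      using t by (simp only: emeasure_density sets_scalar_measure)
  qed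
  also have "\<dots> = emeasure (scalar_measure E (E \<sigma> f)) \<tau>"
    using s t by (simp add: sets_scalar_measure emeasure_scalar_measure E_Int)
  finally show "emeasure (scalar_measure E (E \<sigma> f)) \<tau>
      = emeasure (density (scalar_measure E f) (\<lambda>t. ennreal (indicat_real \<sigma> t))) \<tau>" ..
qed (simp add: sets_scalar_measure)

end

section \<open>Spectral resolutions\<close>

locale spectral_resolution = projection_valued_measure E
  for E :: "real set \<Rightarrow> 'a::complex_hilbert \<Rightarrow> 'a" +
  fixes B :: "'a operator"
  assumes is_spectral_measure: "is_spectral_measure_of E B"
    and selfadjoint: "selfadjoint_op B"
begin

abbreviation b :: "'a \<Rightarrow> 'a" where "b f \<equiv> the (B f)"

lemma linear: "linear_op B"
  and dom_B: "f \<in> dom B \<longleftrightarrow> (\<integral>\<^sup>+ t. ennreal (t\<^sup>2) \<partial>scalar_measure E f) < \<infinity>"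
  and form_B: "f \<in> dom B \<Longrightarrow> cinner (b f) f = of_real (\<integral> t. t \<partial>scalar_measure E f)"
  using is_spectral_measure by (auto simp: is_spectral_measure_of_def)

lemma dense: "densely_defined B"
  using selfadjoint by (simp add: selfadjoint_op_def)

lemma B_eq_Some: "f \<in> dom B \<Longrightarrow> B f = Some (b f)"
  by auto

lemma b_add: "f \<in> dom B \<Longrightarrow> g \<in> dom B \<Longrightarrow> f + g \<in> dom B \<and> b (f + g) = b f + b g"
  using linear_op_add[OF linear] by fastforce

lemma b_diff: "f \<in> dom B \<Longrightarrow> g \<in> dom B \<Longrightarrow> f - g \<in> dom B \<and> b (f - g) = b f - b g"
  using linear_op_diff[OF linear] by fastforce

lemma b_scaleC: "f \<in> dom B \<Longrightarrow> a *\<^sub>C f \<in> dom B \<and> b (a *\<^sub>C f) = a *\<^sub>C b f"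
  using linear_op_scaleC[OF linear] by fastforce

lemma measurable_scalar_measure [measurable]:
  "g \<in> borel_measurable borel \<Longrightarrow> g \<in> borel_measurable (scalar_measure E f)"
  by (subst measurable_cong_sets[OF sets_scalar_measure refl]) (rule measurable_restrict_space1)

lemma integrable_id_scalar_measure:
  assumes "f \<in> dom B"
  shows "integrable (scalar_measure E f) (\<lambda>t. t)"
proof -
  interpret finite_measure "scalar_measure E f" by (rule finite_measure_scalar_measure)
  have "integrable (scalar_measure E f) (\<lambda>t. t\<^sup>2)"
    using assms dom_B[of f] by (intro integrableI_nonneg) (auto intro: measurable_scalar_measure)
  then have "integrable (scalar_measure E f) (\<lambda>t. 1 + t\<^sup>2)" by simp
  then show ?thesis
  proof (rule Bochner_Integration.integrable_bound)
    have "\<bar>t\<bar> \<le> 1 + t\<^sup>2" for t :: real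
      using sum_squares_bound[of 1 "\<bar>t\<bar>"] by simp
    then show "AE t in scalar_measure E f. norm t \<le> norm (1 + t\<^sup>2)" by simp
  qed (auto intro: measurable_scalar_measure)
qed

lemma form_lower_bound:
  assumes f: "f \<in> dom B" "E \<sigma> f = f" and s: "\<sigma> \<in> sets borel_Rplus" "\<And>t. t \<in> \<sigma> \<Longrightarrow> c \<le> t"
  shows "c * (norm f)\<^sup>2 \<le> Re (cinner (b f) f)"
proof -
  interpret finite_measure "scalar_measure E f" by (rule finite_measure_scalar_measure)
  have "(\<integral> t. c \<partial>scalar_measure E f) \<le> (\<integral> t. t \<partial>scalar_measure E f)"
    using AE_scalar_measure[OF s(1) f(2)] s(2)
    by (intro integral_mono_AE integrable_id_scalar_measure f(1)) auto
  then show ?thesis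
    by (simp add: form_B f measure_space_scalar_measure mult.commute)
qed

lemma form_upper_bound:
  assumes f: "f \<in> dom B" "E \<sigma> f = f" and s: "\<sigma> \<in> sets borel_Rplus" "\<And>t. t \<in> \<sigma> \<Longrightarrow> t \<le> c"
  shows "Re (cinner (b f) f) \<le> c * (norm f)\<^sup>2"
proof -
  interpret finite_measure "scalar_measure E f" by (rule finite_measure_scalar_measure)
  have "(\<integral> t. t \<partial>scalar_measure E f) \<le> (\<integral> t. c \<partial>scalar_measure E f)"
    using AE_scalar_measure[OF s(1) f(2)] s(2)
    by (intro integral_mono_AE integrable_id_scalar_measure f(1)) auto
  then show ?thesis
    by (simp add: form_B f measure_space_scalar_measure mult.commute)
qed

lemma proj_in_dom:
  assumes s: "\<sigma> \<in> sets borel_Rplus" and f: "f \<in> dom B"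
  shows "E \<sigma> f \<in> dom B"
proof -
  have "(\<integral>\<^sup>+ t. ennreal (t\<^sup>2) \<partial>scalar_measure E (E \<sigma> f))
      = (\<integral>\<^sup>+ t. ennreal (indicat_real \<sigma> t) * ennreal (t\<^sup>2) \<partial>scalar_measure E f)"
    unfolding scalar_measure_proj[OF s] using s
    by (intro nn_integral_density) (auto simp: sets_scalar_measure intro: measurable_scalar_measure)
  also have "\<dots> \<le> (\<integral>\<^sup>+ t. ennreal (t\<^sup>2) \<partial>scalar_measure E f)"
    by (intro nn_integral_mono) (simp split: split_indicator)
  also have "\<dots> < \<infinity>" using f by (simp add: dom_B)
  finally show ?thesis by (simp add: dom_B)
qed

lemma integral_proj:
  assumes s: "\<sigma> \<in> sets borel_Rplus"
  shows "(\<integral> t. t \<partial>scalar_measure E (E \<sigma> f)) = (\<integral> t. indicat_real \<sigma> t * t \<partial>scalar_measure E f)"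
  unfolding scalar_measure_proj[OF s] using s
  by (subst integral_density) (auto simp: sets_scalar_measure intro: measurable_scalar_measure)

text \<open>Additivity of the integral over \<sigma> and its complement, read as the absence of
  cross terms in the quadratic form of \<open>B\<close>.\<close>

lemma form_split:
  assumes s: "\<sigma> \<in> sets borel_Rplus" and f: "f \<in> dom B"
  shows "cinner (b f) f
    = cinner (b (E \<sigma> f)) (E \<sigma> f) + cinner (b (E ({0..} - \<sigma>) f)) (E ({0..} - \<sigma>) f)"
proof -
  let ?M = "scalar_measure E f"
  note s' = E_compl(1)[OF s]
  have int: "integrable ?M (\<lambda>t. indicat_real \<tau> t * t)" if "\<tau> \<in> sets borel_Rplus" for \<tau>
    using integrable_real_mult_indicator[OF _ integrable_id_scalar_measure[OF f], of \<tau>] that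
    by (simp add: sets_scalar_measure mult.commute)
  have "(\<integral> t. t \<partial>?M) = (\<integral> t. indicat_real \<sigma> t * t + indicat_real ({0..} - \<sigma>) t * t \<partial>?M)"
    by (intro Bochner_Integration.integral_cong) (auto split: split_indicator)
  also have "\<dots> = (\<integral> t. indicat_real \<sigma> t * t \<partial>?M) + (\<integral> t. indicat_real ({0..} - \<sigma>) t * t \<partial>?M)"
    by (intro Bochner_Integration.integral_add int s s')
  finally show ?thesis
    by (simp add: form_B f proj_in_dom s s' integral_proj)
qed

text \<open>Polarization: \<open>form_split\<close> at \<open>x + y\<close> makes the sum of
  \<open>cinner (b x) y\<close> and \<open>cinner (b y) x\<close> vanish, and the same at
  \<open>x + \<i> *\<^sub>C y\<close> makes their difference vanish.\<close>

lemma cinner_cross_zero: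
  assumes s: "\<sigma> \<in> sets borel_Rplus" and x: "x \<in> dom B" "E \<sigma> x = x" and y: "y \<in> dom B" "E \<sigma> y = 0"
  shows "cinner (b x) y = 0"
proof -
  note P = projection[OF s]
  have sum: "cinner (b x) z + cinner (b z) x = 0" if z: "z \<in> dom B" "E \<sigma> z = 0" for z
  proof -
    have "E \<sigma> (x + z) = x" using x z by (simp add: proj_add[OF P])
    moreover from this have "E ({0..} - \<sigma>) (x + z) = z" by (simp add: E_compl(2)[OF s])
    moreover have "x + z \<in> dom B" "b (x + z) = b x + b z" using b_add[OF x(1) z(1)] by auto
    ultimately show ?thesis
      using form_split[OF s, of "x + z"] by (simp add: cinner_add_left cinner_add_right add.commute)
  qed
  have "E \<sigma> (\<i> *\<^sub>C y) = 0"
    by (simp add: proj_scaleC[OF P] y(2))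
  then have "- \<i> * cinner (b x) y + \<i> * cinner (b y) x = 0"
    using sum[of "\<i> *\<^sub>C y"] b_scaleC[OF y(1), of \<i>] by (simp add: cinner_scaleC_left cinner_scaleC_right)
  then have "cinner (b y) x = cinner (b x) y" by (simp add: algebra_simps)
  then show ?thesis using sum[OF y] by simp
qed

text \<open>\<open>B\<close> maps the part of its domain in the range of any \<open>E \<tau>\<close>
  into that range: the image is orthogonal to \<open>g - E \<tau> g\<close> for all \<open>g\<close>
  in the dense domain. Apply this to \<sigma> and to its complement.\<close>

lemma proj_commute:
  assumes s: "\<sigma> \<in> sets borel_Rplus" and f: "f \<in> dom B"
  shows "b (E \<sigma> f) = E \<sigma> (b f)"
proof -
  have range: "E \<tau> (b (E \<tau> f)) = b (E \<tau> f)" if t: "\<tau> \<in> sets borel_Rplus" for \<tau>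
  proof -
    note P = projection[OF t]
    have "cinner (b (E \<tau> f) - E \<tau> (b (E \<tau> f))) g = 0" if g: "g \<in> dom B" for g
    proof -
      have "cinner (b (E \<tau> f)) (g - E \<tau> g) = 0"
        using t f g b_diff[OF g proj_in_dom[OF t g]]
        by (intro cinner_cross_zero[OF t] proj_in_dom)
          (simp_all add: proj_idem[OF P] proj_diff[OF P])
      then show ?thesis
        by (simp add: cinner_diff_left cinner_diff_right proj_selfadjoint[OF P])
    qed
    then show ?thesis
      using cinner_dense_eq_0 dense unfolding densely_defined_def by (metis eq_iff_diff_eq_0)
  qed
  note s' = E_compl(1)[OF s] and P = projection[OF s]
  have "E \<sigma> (b (E ({0..} - \<sigma>) f)) = 0"
    using range[OF s'] E_disjoint[OF s s'] by (metis Diff_disjoint)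
  moreover have "b f = b (E \<sigma> f) + b (E ({0..} - \<sigma>) f)"
    using b_add[OF proj_in_dom[OF s f] proj_in_dom[OF s' f]] by (simp add: E_compl(2)[OF s])
  ultimately show ?thesis by (simp add: proj_add[OF P] range[OF s])
qed

text \<open>Cauchy-Schwarz turns a lower bound of the form into one of the norm. It does not do so
  for upper bounds, hence the different argument on cutoffs that follows.\<close>

lemma B_expanding:
  assumes f: "f \<in> dom B" "E \<sigma> f = f" and s: "\<sigma> \<in> sets borel_Rplus" "\<And>t. t \<in> \<sigma> \<Longrightarrow> c \<le> t"
  shows "c * norm f \<le> norm (b f)"
proof (cases "f = 0")
  case False
  have "c * (norm f)\<^sup>2 \<le> cmod (cinner (b f) f)"
    using form_lower_bound[OF assms] complex_Re_le_cmod order_trans by blast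
  also have "\<dots> \<le> norm (b f) * norm f" by (rule Cauchy_Schwarz_cinner)
  finally show ?thesis using False by (simp add: power2_eq_square)
qed simp

text \<open>On the range of \<open>E [0, a]\<close> the form of \<open>B\<close> is bounded above by \<open>c > a\<close>, and its value at
  \<open>f - B f / c\<close> is nonnegative.\<close>

lemma B_bounded_on_cutoff:
  assumes a: "0 \<le> a" and f: "E {0..a} f = f"
  shows "f \<in> dom B" and "E {0..a} (b f) = b f" and "norm (b f) \<le> a * norm f"
proof -
  have s: "{0..a} \<in> sets borel_Rplus" by (simp add: sets_borel_Rplus)
  have dom: "g \<in> dom B" if g: "E {0..a} g = g" for g
  proof -
    have "(\<integral>\<^sup>+ t. ennreal (t\<^sup>2) \<partial>scalar_measure E g) \<le> (\<integral>\<^sup>+ t. ennreal (a\<^sup>2) \<partial>scalar_measure E g)"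
    proof (rule nn_integral_mono_AE)
      show "AE t in scalar_measure E g. ennreal (t\<^sup>2) \<le> ennreal (a\<^sup>2)"
        using AE_scalar_measure[OF s g] by eventually_elim (auto intro!: ennreal_leI power_mono)
    qed
    also have "\<dots> = ennreal (a\<^sup>2) * emeasure (scalar_measure E g) {0..}" by simp
    also have "\<dots> < \<infinity>"
      by (simp add: emeasure_scalar_measure sets_borel_Rplus ennreal_mult_less_top)
    finally show ?thesis by (simp add: dom_B)
  qed
  show "f \<in> dom B" by (rule dom[OF f])
  show bf: "E {0..a} (b f) = b f" using proj_commute[OF s dom[OF f]] f by simp
  note P = projection[OF s]
  show "norm (b f) \<le> a * norm f"
  proof (cases "f = 0")
    case True
    then show ?thesis using linear_op_zero[OF linear] by simp
  next
    case f0: False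
    \<comment> \<open>Taking \<open>c > a\<close> keeps the divisor \<open>c\<close> positive even
      for \<open>a = 0\<close>; afterwards \<open>c\<close> decreases to \<open>a\<close>.\<close>
    have "norm (b f) \<le> c * norm f" if c: "a < c" for c
    proof -
      define r where "r = complex_of_real (1 / c)"
      have c0: "0 < c" using a c by simp
      let ?g = "f - r *\<^sub>C b f"
      have g: "?g \<in> dom B" "b ?g = b f - r *\<^sub>C b (b f)"
        using b_diff[OF dom[OF f]] b_scaleC[OF dom[OF bf], of r] by auto
      have Eg: "E {0..a} ?g = ?g" using f bf by (simp add: proj_diff[OF P] proj_scaleC[OF P])
      have sym: "cinner (b (b f)) f = cinner (b f) (b f)"
        using selfadjoint_op_symmetric[OF selfadjoint] B_eq_Some dom bf f by metis
      have up: "Re (cinner (b (b f)) (b f)) \<le> c * (norm (b f))\<^sup>2"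
        using c by (intro form_upper_bound[OF dom[OF bf] bf s]) auto
      have up': "Re (cinner (b f) f) \<le> c * (norm f)\<^sup>2"
        using c by (intro form_upper_bound[OF dom[OF f] f s]) auto
      have "0 \<le> Re (cinner (b ?g) ?g)"
        using form_lower_bound[OF g(1) Eg s, of 0] by simp
      also have "cinner (b ?g) ?g
          = cinner (b f) f - r * (2 * cinner (b f) (b f)) + r * r * cinner (b (b f)) (b f)"
        unfolding g(2)
        by (simp add: cinner_diff_left cinner_diff_right cinner_scaleC_left cinner_scaleC_right sym r_def
            algebra_simps)
      finally have "2 * (norm (b f))\<^sup>2 / c
          \<le> Re (cinner (b f) f) + Re (cinner (b (b f)) (b f)) / c\<^sup>2"
        by (simp add: r_def cinner_norm power2_eq_square flip: of_real_mult)
      \<comment> \<open>The last summand equals the square of \<open>norm (b f)\<close> divided by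
        \<open>c\<close>, half of the left side, and is absorbed there.\<close>
      also have "\<dots> \<le> c * (norm f)\<^sup>2 + c * (norm (b f))\<^sup>2 / c\<^sup>2"
        using up up' by (intro add_mono divide_right_mono) auto
      finally have "(norm (b f))\<^sup>2 \<le> (c * norm f)\<^sup>2"
        using c0 by (simp add: field_simps power2_eq_square)
      then show ?thesis using c0 by (metis less_imp_le mult_nonneg_nonneg norm_ge_zero power2_le_imp_le)
    qed
    then have "norm (b f) / norm f \<le> a"
      using f0 by - (rule dense_ge, simp add: divide_le_eq)
    then show ?thesis using f0 by (simp add: divide_le_eq)
  qed
qed

end

section \<open>Uniqueness of the spectral measure\<close>

context spectral_resolution
begin

text \<open>With its converse below, this describes the range of \<open>E {0..a}\<close> by the
  existence of a geometrically bounded orbit. The orbit is taken under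
  \<open>B \<circ>\<^sub>m B\<close>, so that the description mentions neither \<open>E\<close> nor
  \<open>B\<close> itself and can be compared between two resolutions.\<close>

lemma cutoff_powers_bound:
  assumes a: "0 \<le> a" and f: "E {0..a} f = f"
  shows "\<exists>x. x 0 = f \<and> (\<forall>n. (B \<circ>\<^sub>m B) (x n) = Some (x (Suc n)) \<and> norm (x n) \<le> a ^ (2 * n) * norm f)"
proof -
  define x where "x n = ((\<lambda>f. b (b f)) ^^ n) f" for n
  have x: "E {0..a} (x n) = x n \<and> norm (x n) \<le> a ^ (2 * n) * norm f" for n
  proof (induction n)
    case (Suc n)
    note 1 = B_bounded_on_cutoff[OF a conjunct1[OF Suc]]
    note 2 = B_bounded_on_cutoff[OF a 1(2)]
    have "norm (b (b (x n))) \<le> a * (a * (a ^ (2 * n) * norm f))"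
      using 1(3) 2(3) Suc a by (meson mult_left_mono order_trans)
    with 2(2) show ?case by (simp add: x_def algebra_simps)
  qed (simp add: x_def f)
  moreover have "(B \<circ>\<^sub>m B) (x n) = Some (x (Suc n))" for n
    using B_bounded_on_cutoff[OF a, of "x n"] B_bounded_on_cutoff[OF a, of "b (x n)"] x[of n]
    by (auto simp: map_comp_def x_def)
  ultimately show ?thesis by (intro exI[of _ x]) (simp add: x_def)
qed

text \<open>The component \<open>y\<close> of \<open>f\<close> in the range of \<open>E (c, \<infinity>)\<close>, \<open>c > a\<close>, satisfies
  \<open>c\<^sup>2\<^sup>n \<parallel>y\<parallel> \<le> \<parallel>B\<^sup>2\<^sup>n y\<parallel> \<le> a\<^sup>2\<^sup>n \<parallel>f\<parallel>\<close>.\<close>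

lemma powers_bound_imp_cutoff:
  assumes a: "0 \<le> a" and x0: "x 0 = f"
    and xB: "\<And>n. (B \<circ>\<^sub>m B) (x n) = Some (x (Suc n))"
    and xa: "\<And>n. norm (x n) \<le> a ^ (2 * n) * norm f"
  shows "E {0..a} f = f"
proof -
  have x: "x n \<in> dom B" "b (x n) \<in> dom B" "x (Suc n) = b (b (x n))" for n
    using xB[of n] by (auto simp: map_comp_def split: option.splits)
  have zero: "E {c<..} f = 0" if c: "a < c" for c
  proof -
    have s: "{c<..} \<in> sets borel_Rplus" using a c by (auto simp: sets_borel_Rplus)
    note P = projection[OF s]
    have c0: "0 < c" using a c by simp
    have y: "c ^ (2 * n) * norm (E {c<..} f) \<le> norm (E {c<..} (x n))" for n
    proof (induction n)
      case (Suc n)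
      let ?y = "E {c<..} (x n)"
      have y: "?y \<in> dom B" "b ?y = E {c<..} (b (x n))" "b ?y \<in> dom B" "b (b ?y) = E {c<..} (x (Suc n))"
        using proj_in_dom[OF s] proj_commute[OF s] x[of n] by auto
      have "c * norm ?y \<le> norm (b ?y)"
        by (rule B_expanding[OF y(1) proj_idem[OF P] s]) simp
      moreover have "c * norm (b ?y) \<le> norm (b (b ?y))"
        by (rule B_expanding[OF y(3) _ s]) (simp_all add: y(2) proj_idem[OF P])
      ultimately have "c * (c * norm ?y) \<le> norm (E {c<..} (x (Suc n)))"
        unfolding y(4) using c0 by (meson less_imp_le mult_left_mono order_trans)
      moreover have "c * (c * (c ^ (2 * n) * norm (E {c<..} f))) \<le> c * (c * norm ?y)"
        using Suc c0 by (intro mult_left_mono) auto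
      ultimately show ?case by (simp add: algebra_simps)
    qed (simp add: x0)
    have "norm (E {c<..} f) \<le> ((a / c)\<^sup>2) ^ n * norm f" for n
    proof -
      have "c ^ (2 * n) * norm (E {c<..} f) \<le> a ^ (2 * n) * norm f"
        using y[of n] norm_proj_le[OF P, of "x n"] xa[of n] by linarith
      then show ?thesis
        using c0 by (simp add: power_divide field_simps flip: power_mult)
    qed
    moreover have "(\<lambda>n. ((a / c)\<^sup>2) ^ n * norm f) \<longlonglongrightarrow> 0 * norm f"
    proof (intro tendsto_mult tendsto_const LIMSEQ_power_zero)
      have "a / c < 1" "0 \<le> a / c" using a c by auto
      then show "norm ((a / c)\<^sup>2) < 1" by (simp add: power_less_one_iff abs_square_less_1)
    qed
    ultimately have "norm (E {c<..} f) \<le> 0 * norm f"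
      by (intro LIMSEQ_le_const) auto
    then show ?thesis by simp
  qed
  have s: "{0..a} \<in> sets borel_Rplus" "{a<..} \<in> sets borel_Rplus"
    using a by (auto simp: sets_borel_Rplus)
  \<comment> \<open>Geometric decay requires \<open>c > a\<close> strictly, so the tail from
    \<open>a\<close> is reached as a countable union of tails that start later.\<close>
  have U: "{a<..} = (\<Union>n. {a + inverse (real (Suc n))<..})"
  proof (intro set_eqI iffI)
    fix t assume "t \<in> {a<..}"
    then show "t \<in> (\<Union>n. {a + inverse (real (Suc n))<..})"
      using reals_Archimedean[of "t - a"] by (auto simp: algebra_simps)
  qed (auto intro: less_trans[rotated] simp: add_strict_increasing)
  have "{a + inverse (real (Suc n))<..} \<in> null_sets (scalar_measure E f)" for n
  proof -
    have "0 \<le> a + inverse (real (Suc n))" using a by simp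
    then have "{a + inverse (real (Suc n))<..} \<in> sets borel_Rplus"
      unfolding sets_borel_Rplus by fastforce
    then show ?thesis
      by (simp add: null_sets_def sets_scalar_measure emeasure_scalar_measure zero)
  qed
  then have "{a<..} \<in> null_sets (scalar_measure E f)"
    unfolding U by (rule null_sets_UN)
  then have "E {a<..} f = 0"
    using s by (simp add: null_sets_def emeasure_scalar_measure)
  moreover have "{0..} - {0..a} = {a<..}" using a by auto
  ultimately show ?thesis using E_compl(2)[OF s(1), of f] by simp
qed

end

text \<open>Equal cutoffs give equal tail projections, hence equal tails of the scalar measures,
  hence equal measures. Their values are squared norms, and a projection fixes a vector iff it
  preserves its norm, so the ranges of \<open>E \<sigma>\<close> and \<open>E' \<sigma>\<close>
  coincide.\<close>

lemma spectral_measure_unique: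
  assumes E: "spectral_resolution E B" and E': "spectral_resolution E' B'"
    and eq: "B \<circ>\<^sub>m B = B' \<circ>\<^sub>m B'" and s: "\<sigma> \<in> sets borel_Rplus"
  shows "E \<sigma> f = E' \<sigma> f"
proof -
  interpret E: spectral_resolution E B by fact
  interpret E': spectral_resolution E' B' by fact
  have cutoff: "E {0..a} f = E' {0..a} f" if a: "0 \<le> a" for a f
  proof (rule proj_eqI[of "E {0..a}" "E' {0..a}"])
    show "orthogonal_projection (E {0..a})" "orthogonal_projection (E' {0..a})"
      by (auto intro!: E.projection E'.projection simp: sets_borel_Rplus)
    show "E {0..a} g = g \<longleftrightarrow> E' {0..a} g = g" for g
      using E.cutoff_powers_bound[OF a, of g] E'.cutoff_powers_bound[OF a, of g]
        E.powers_bound_imp_cutoff[OF a, of _ g] E'.powers_bound_imp_cutoff[OF a, of _ g]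
      unfolding eq by blast
  qed
  \<comment> \<open>The tail criterion for measures on the line runs over all real \<open>x\<close>;
    intersecting with \<open>{0..}\<close> covers the negative ones, where the tail is the whole
    space.\<close>
  have tail: "E ({x<..} \<inter> {0..}) f = E' ({x<..} \<inter> {0..}) f" for x f
  proof (cases "0 \<le> x")
    case True
    then have x: "{x<..} \<inter> {0..} = {0..} - {0..x}" "{0..x} \<in> sets borel_Rplus"
      by (auto simp: sets_borel_Rplus)
    show ?thesis unfolding x(1) E.E_compl(2)[OF x(2)] E'.E_compl(2)[OF x(2)] cutoff[OF True] ..
  next
    case False
    then have "{x<..} \<inter> {0..} = {0..}" by auto
    then show ?thesis by (simp add: E.E_space E'.E_space)
  qed
  \<comment> \<open>The scalar measures live on \<open>{0..}\<close>; they are pushed forward to the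
    whole line to match that criterion.\<close>
  have distr: "emeasure (distr (scalar_measure F f) borel (\<lambda>t. t)) \<tau> = ennreal ((norm (F (\<tau> \<inter> {0..}) f))\<^sup>2)"
    if "projection_valued_measure F" "\<tau> \<in> sets borel" for F and f :: 'a and \<tau>
  proof -
    interpret projection_valued_measure F by fact
    have "(\<lambda>t. t) \<in> borel_measurable (scalar_measure F f)"
      by (subst measurable_cong_sets[OF sets_scalar_measure refl]) (intro measurable_restrict_space1 measurable_ident_sets refl)
    moreover have "\<tau> \<inter> {0..} \<in> sets borel_Rplus" using that(2) by (simp add: sets_borel_Rplus)
    ultimately show ?thesis
      using that(2) by (simp add: emeasure_distr emeasure_scalar_measure)
  qed
  note distr = distr[OF E.projection_valued_measure_axioms] distr[OF E'.projection_valued_measure_axioms]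
  have norm_eq: "norm (E \<sigma> f) = norm (E' \<sigma> f)" for f
  proof -
    have "distr (scalar_measure E f) borel (\<lambda>t. t) = distr (scalar_measure E' f) borel (\<lambda>t. t)"
      by (rule measure_eqI_lessThan) (simp_all add: distr tail)
    moreover have "\<sigma> \<in> sets borel" "\<sigma> \<inter> {0..} = \<sigma>" using s by (auto simp: sets_borel_Rplus)
    ultimately have "ennreal ((norm (E \<sigma> f))\<^sup>2) = ennreal ((norm (E' \<sigma> f))\<^sup>2)"
      by (metis distr)
    then show ?thesis by (simp add: power2_eq_iff_nonneg)
  qed
  note P = E.projection[OF s] and P' = E'.projection[OF s]
  show ?thesis
  proof (rule proj_eqI[OF P P'])
    show "E \<sigma> g = g \<longleftrightarrow> E' \<sigma> g = g" for g
      using proj_eq_self[OF P, of g] proj_eq_self[OF P', of g] norm_eq[of g] by auto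
  qed
qed

section \<open>Weak quasinormality bounds and the equivalence\<close>

lemma modulus_spectral_resolution:
  assumes A: "linear_op A" "closed_op A" "densely_defined A"
    and B: "is_modulus A B" "is_spectral_measure_of E B"
  shows "spectral_resolution E B"
    and "\<sigma> \<in> sets borel_Rplus \<Longrightarrow> f \<in> dom A \<Longrightarrow> E \<sigma> f \<in> dom A"
    and "\<sigma> \<in> sets borel_Rplus \<Longrightarrow> f \<in> dom A \<Longrightarrow>
      Re (cinner (E \<sigma> (the (B f))) (the (B f))) = (norm (the (A (E \<sigma> f))))\<^sup>2"
proof -
  show res: "spectral_resolution E B"
    using B by unfold_locales (auto simp: is_modulus_def is_spectral_measure_of_def)
  interpret spectral_resolution E B by (rule res)
  note AB = modulus_dom_norm[OF A B(1)]
  assume *: "\<sigma> \<in> sets borel_Rplus" "f \<in> dom A"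
  then show "E \<sigma> f \<in> dom A" using proj_in_dom[of \<sigma> f] AB(1) by simp
  have "norm (the (A (E \<sigma> f))) = norm (E \<sigma> (the (B f)))"
    using proj_commute[of \<sigma> f] * AB(1) AB(2)[of "E \<sigma> f"] by simp
  then show "Re (cinner (E \<sigma> (the (B f))) (the (B f))) = (norm (the (A (E \<sigma> f))))\<^sup>2"
    by (simp add: cinner_proj_self[OF projection[OF *(1)]])
qed

text \<open>Each bound comes with its own witnesses \<open>B'\<close> and \<open>E'\<close>. The
  norm identity for the modulus removes \<open>B'\<close> from the inequality, and uniqueness
  replaces \<open>E'\<close> by \<open>E\<close>; one fixed pair then serves all
  \<open>c\<close>.\<close>

lemma weak_quasinormality_bound_iff:
  assumes A: "linear_op A" "closed_op A" "densely_defined A"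
    and B: "is_modulus A B" "is_spectral_measure_of E B"
  shows "weak_quasinormality_bound A c \<longleftrightarrow> 0 \<le> c \<and>
    (\<forall>\<sigma>\<in>sets borel_Rplus. \<forall>f\<in>dom A.
      (norm (the (A (E \<sigma> f))))\<^sup>2 \<le> c * (norm (E \<sigma> (the (A f))))\<^sup>2)"
proof -
  note res = modulus_spectral_resolution[OF A]
  interpret spectral_resolution E B by (rule res(1)[OF B])
  have same: "(\<forall>\<sigma>\<in>sets borel_Rplus. \<forall>f\<in>dom A.
        Re (cinner (E' \<sigma> (the (B' f))) (the (B' f))) \<le> c * Re (cinner (E' \<sigma> (the (A f))) (the (A f))))
      \<longleftrightarrow> (\<forall>\<sigma>\<in>sets borel_Rplus. \<forall>f\<in>dom A.
        (norm (the (A (E \<sigma> f))))\<^sup>2 \<le> c * (norm (E \<sigma> (the (A f))))\<^sup>2)"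
    if B': "is_modulus A B'" "is_spectral_measure_of E' B'" for B' E'
  proof -
    have eq: "B' \<circ>\<^sub>m B' = B \<circ>\<^sub>m B" using B B' by (simp add: is_modulus_def)
    note un = spectral_measure_unique[OF res(1)[OF B'] res(1)[OF B] eq]
    have "Re (cinner (E' \<sigma> (the (B' f))) (the (B' f))) = (norm (the (A (E \<sigma> f))))\<^sup>2"
      and "Re (cinner (E' \<sigma> (the (A f))) (the (A f))) = (norm (E \<sigma> (the (A f))))\<^sup>2"
      if "\<sigma> \<in> sets borel_Rplus" "f \<in> dom A" for \<sigma> f
      using res(3)[OF B' that] un[OF that(1)] cinner_proj_self[OF projection[OF that(1)]] by auto
    then show ?thesis by simp
  qed
  show ?thesis
    unfolding weak_quasinormality_bound_def using same B by blast
qed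


lemma weak_quasinormality_bound_one_le:
  assumes A: "linear_op A" "closed_op A" "densely_defined A" and ne: "f \<in> dom A" "the (A f) \<noteq> 0"
    and c: "weak_quasinormality_bound A c"
  shows "1 \<le> c"
proof -
  obtain B E where B: "is_modulus A B" "is_spectral_measure_of E B"
    using c by (auto simp: weak_quasinormality_bound_def)
  interpret spectral_resolution E B by (rule modulus_spectral_resolution(1)[OF A B])
  have "(norm (the (A (E {0..} f))))\<^sup>2 \<le> c * (norm (E {0..} (the (A f))))\<^sup>2"
    using c ne unfolding weak_quasinormality_bound_iff[OF A B] by (auto simp: sets_borel_Rplus)
  then show ?thesis using ne(2) by (simp add: E_space)
qed

text \<open>The bounds are the solutions of a family of weak linear inequalities, hence the least one exists.\<close>

lemma weak_quasinormality_constant_attained: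
  assumes A: "linear_op A" "closed_op A" "densely_defined A"
    and c: "weak_quasinormality_bound A c"
  shows "weak_quasinormality_bound A (weak_quasinormality_constant A)"
proof -
  obtain B E where B: "is_modulus A B" "is_spectral_measure_of E B"
    using c by (auto simp: weak_quasinormality_bound_def)
  note iff = weak_quasinormality_bound_iff[OF A B]
  define S where "S = Collect (weak_quasinormality_bound A)"
  have S: "S = {0..} \<inter> (\<Inter>\<sigma>\<in>sets borel_Rplus. \<Inter>f\<in>dom A.
      {c. (norm (the (A (E \<sigma> f))))\<^sup>2 \<le> c * (norm (E \<sigma> (the (A f))))\<^sup>2})"
    unfolding S_def iff by auto
  have "closed S"
    unfolding S by (intro closed_Int closed_INT ballI closed_Collect_le continuous_intros)
  moreover have "S \<noteq> {}" using c by (auto simp: S_def)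
  moreover have "bdd_below S" by (rule bdd_belowI[of _ 0]) (simp add: S)
  ultimately have "Inf S \<in> S" and "\<And>d. d \<in> S \<Longrightarrow> Inf S \<le> d"
    by (auto intro: closed_contains_Inf cInf_lower)
  then have "weak_quasinormality_constant A = Inf S"
    unfolding weak_quasinormality_constant_def by (intro Least_equality) (auto simp: S_def)
  with \<open>Inf S \<in> S\<close> show ?thesis by (simp add: S_def)
qed

lemma quasinormal_bound_one:
  assumes "quasinormal A"
  shows "weak_quasinormality_bound A 1"
proof -
  have A: "linear_op A" "closed_op A" "densely_defined A"
    using assms by (auto simp: quasinormal_def)
  obtain B E where B: "is_modulus A B" "is_spectral_measure_of E B"
    and comm: "\<And>\<sigma>. \<sigma> \<in> sets borel_Rplus \<Longrightarrow> (Some \<circ> E \<sigma>) \<circ>\<^sub>m A \<subseteq>\<^sub>m A \<circ>\<^sub>m (Some \<circ> E \<sigma>)"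
    using assms by (auto simp: quasinormal_def)
  have "the (A (E \<sigma> f)) = E \<sigma> (the (A f))" if s: "\<sigma> \<in> sets borel_Rplus" and f: "f \<in> dom A" for \<sigma> f
  proof -
    have "((Some \<circ> E \<sigma>) \<circ>\<^sub>m A) f = Some (E \<sigma> (the (A f)))" using f by (auto simp: map_comp_def)
    then have "(A \<circ>\<^sub>m (Some \<circ> E \<sigma>)) f = Some (E \<sigma> (the (A f)))"
      using comm[OF s] by (metis domI map_le_def)
    then show ?thesis by (simp add: map_comp_def)
  qed
  then show ?thesis unfolding weak_quasinormality_bound_iff[OF A B] by simp
qed

text \<open>Adding the inequalities for \<open>\<sigma>\<close> and its complement gives \<open>\<parallel>A f\<parallel>\<^sup>2 \<le> \<parallel>A f\<parallel>\<^sup>2\<close>, so that both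
  are equalities. Hence \<open>E(\<sigma>) A\<close> vanishes on the range of \<open>I - E(\<sigma>)\<close> and \<open>(I - E(\<sigma>)) A\<close> on the
  range of \<open>E(\<sigma>)\<close>.\<close>

lemma bound_one_quasinormal:
  assumes A: "linear_op A" "closed_op A" "densely_defined A"
    and bound: "weak_quasinormality_bound A 1"
  shows "quasinormal A"
proof -
  obtain B E where B: "is_modulus A B" "is_spectral_measure_of E B"
    using bound by (auto simp: weak_quasinormality_bound_def)
  note res = modulus_spectral_resolution[OF A B]
  interpret spectral_resolution E B by (rule res(1))
  let ?A = "\<lambda>f. the (A f)"
  have le: "(norm (?A (E \<sigma> f)))\<^sup>2 \<le> (norm (E \<sigma> (?A f)))\<^sup>2"
    if "\<sigma> \<in> sets borel_Rplus" "f \<in> dom A" for \<sigma> f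
    using bound that unfolding weak_quasinormality_bound_iff[OF A B] by simp
  have pyth: "(norm (g - E \<sigma> g))\<^sup>2 = (norm g)\<^sup>2 - (norm (E \<sigma> g))\<^sup>2" if "\<sigma> \<in> sets borel_Rplus" for \<sigma> g
    by (rule norm_diff_proj_sq[OF projection[OF that]])
  have eq: "norm (E \<sigma> (?A f)) = norm (?A (E \<sigma> f))" if s: "\<sigma> \<in> sets borel_Rplus" and f: "f \<in> dom A" for \<sigma> f
  proof -
    have B_A: "norm (?A g) = norm (b g)" for g using modulus_dom_norm(2)[OF A B(1)] by simp
    have f': "f \<in> dom B" using f modulus_dom_norm(1)[OF A B(1)] by simp
    \<comment> \<open>Pythagoras is available for values of \<open>B\<close>, which commutes with
      \<open>E \<sigma>\<close>; \<open>B_A\<close> transfers it to \<open>A\<close>, for which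
      commutation is still to be proved.\<close>
    have "norm (?A (f - E \<sigma> f)) = norm (b f - E \<sigma> (b f))"
      using b_diff[OF f' proj_in_dom[OF s f']] by (simp add: B_A proj_commute[OF s f'])
    then have "(norm (?A (f - E \<sigma> f)))\<^sup>2 = (norm (?A f))\<^sup>2 - (norm (?A (E \<sigma> f)))\<^sup>2"
      by (simp add: pyth[OF s] B_A proj_commute[OF s f'])
    moreover have "(norm (?A (f - E \<sigma> f)))\<^sup>2 \<le> (norm (?A f))\<^sup>2 - (norm (E \<sigma> (?A f)))\<^sup>2"
      using le[OF E_compl(1)[OF s] f] by (simp add: E_compl(2)[OF s] pyth[OF s])
    ultimately show ?thesis using le[OF s f] by (simp add: power2_eq_iff_nonneg)
  qed
  have "(Some \<circ> E \<sigma>) \<circ>\<^sub>m A \<subseteq>\<^sub>m A \<circ>\<^sub>m (Some \<circ> E \<sigma>)" if s: "\<sigma> \<in> sets borel_Rplus" for \<sigma>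
    unfolding map_le_def
  proof
    fix f assume "f \<in> dom ((Some \<circ> E \<sigma>) \<circ>\<^sub>m A)"
    then obtain u where u: "A f = Some u" by (auto simp: map_comp_def split: option.splits)
    then have f: "f \<in> dom A" by blast
    note P = projection[OF s] and s' = E_compl(1)[OF s]
    note Pf = res(2)[OF s f]
    obtain v where v: "A (E \<sigma> f) = Some v" using Pf by blast
    have d: "A (f - E \<sigma> f) = Some (u - v)" by (rule linear_op_diff[OF A(1) u v])
    have A0: "?A 0 = 0" using linear_op_zero[OF A(1)] by simp
    have "E \<sigma> (f - E \<sigma> f) = 0" by (simp add: proj_diff[OF P] proj_idem[OF P])
    then have "norm (E \<sigma> (u - v)) = 0" using eq[OF s, of "f - E \<sigma> f"] d A0 by (simp add: domI)
    then have "E \<sigma> u = E \<sigma> v" by (simp add: proj_diff[OF P])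
    moreover have "norm (v - E \<sigma> v) = 0"
      using eq[OF s' Pf] v A0 by (simp add: E_compl(2)[OF s] proj_idem[OF P])
    ultimately have "E \<sigma> u = v" by simp
    then show "((Some \<circ> E \<sigma>) \<circ>\<^sub>m A) f = (A \<circ>\<^sub>m (Some \<circ> E \<sigma>)) f"
      using u v by (simp add: map_comp_def)
  qed
  then show ?thesis using A B by (auto simp: quasinormal_def)
qed

theorem theorem5p1:
  fixes A :: "'a::complex_hilbert operator"
  assumes "linear_op A"
    and "closed_op A"
    and "densely_defined A"
    and "\<exists>f\<in>dom A. the (A f) \<noteq> 0"
  shows "quasinormal A \<longleftrightarrow>
    weakly_quasinormal A \<and> weak_quasinormality_constant A = 1"
proof
  assume "quasinormal A"
  then have 1: "weak_quasinormality_bound A 1" by (rule quasinormal_bound_one)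
  moreover have "weak_quasinormality_constant A = 1"
    unfolding weak_quasinormality_constant_def
    using 1 weak_quasinormality_bound_one_le[OF assms(1-3)] assms(4)
    by (intro Least_equality) auto
  ultimately show "weakly_quasinormal A \<and> weak_quasinormality_constant A = 1"
    using assms(1-3) by (auto simp: weakly_quasinormal_def)
next
  assume "weakly_quasinormal A \<and> weak_quasinormality_constant A = 1"
  \<comment> \<open>A \<open>LEAST\<close> value equal to 1 shows that 1 is a bound because the
    minimum is attained.\<close>
  then have "weak_quasinormality_bound A 1"
    using weak_quasinormality_constant_attained[OF assms(1-3)]
    by (auto simp: weakly_quasinormal_def)
  then show "quasinormal A" by (rule bound_one_quasinormal[OF assms(1-3)])
qed

end
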